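(* Let $\alpha\in(\tfrac12,1)$, $s=p^{1-\alpha}$, and $A=\sqrt{2r\log p/n}$ with $r>\alpha$. Assume either $\mathbf X\in\mathrm{SubG}(\sigma^2)$ with $n/p^2\to\infty$, or $\mathbf X\in\mathcal O_n(p)$ with $n\ge p$. Then $$\lim_{p\to\infty}\frac{\log\mathrm{Risk}(s,A)}{s\log p}=-\frac{(r-\alpha)^2}{4r}.$$
   Context: Setting: for each $p$ one observes $(\mathbf y,\mathbf X)$ with $\mathbf y=\mathbf X\boldsymbol\beta+\boldsymbol\varepsilon$, where $\boldsymbol\varepsilon\sim\mathcal N(0,I_n)$, $\mathbf X$ is an $n\times p$ real matrix independent of $\boldsymbol\varepsilon$, $\boldsymbol\beta\in\mathbb R^p$ is unknown, and $n=n(p)\to\infty$ as $p\to\infty$. Design classes: $\mathbf X\in\mathrm{SubG}(\sigma^2)$ means the rows of $\mathbf X$ are i.i.d. centered isotropic ($\mathbb E[xx^T]=I_p$) sub-Gaussian random vectors with sub-Gaussian parameter $\sigma^2$ (for every unit $u$ and $t\in\mathbb R$, $\log\mathbb E e^{t\langle u,x\rangle}\le\sigma^2t^2/2$), and $\mathbf X^T\mathbf X$ is almost surely positive definite; $\mathbf X\in\mathcal O_n(p)$ means $\mathbf X^T\mathbf X=nI_p$. For an integer $s$ and $A>0$, $\Xi(s,A)=\{\boldsymbol\beta\in\mathbb R^p:|\mathrm{supp}(\boldsymbol\beta)|=s,\ |\beta_i|\ge A\text{ for }i\in\mathrm{supp}(\boldsymbol\beta)\}$. A test $T$ is a measurable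 $[0,1]$-valued function of $(\mathbf y,\mathbf X)$; $\mathbb P_{\boldsymbol\beta},\mathbb E_{\boldsymbol\beta}$ denote the law/expectation of $(\mathbf y,\mathbf X)$ (including the randomness of $\mathbf X$) under parameter $\boldsymbol\beta$, and $\mathbb P_0,\mathbb E_0$ those under $\boldsymbol\beta=0$. $\mathrm{Risk}(T,s,A)=\mathbb E_0[T]+\sup_{\boldsymbol\beta\in\Xi(s,A)}\mathbb E_{\boldsymbol\beta}[1-T]$ and $\mathrm{Risk}(s,A)=\inf_T\mathrm{Risk}(T,s,A)$. The sparsity is $s=p^{1-\alpha}$ (rounded to an integer) with $\alpha$ fixed; all limits are as $p\to\infty$. *)

theory Defs
  imports "HOL-Probability.Probability"
begin

text \<open>Vectors in R^k are functions nat => real restricted to indices < k (PiM / PiE);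
  n x p matrices are functions nat => nat => real, entry X i j, i < n, j < p.\<close>

definition vecM :: "nat \<Rightarrow> (nat \<Rightarrow> real) measure" where
  "vecM k = PiM {..<k} (\<lambda>_. borel)"

definition matM :: "nat \<Rightarrow> nat \<Rightarrow> (nat \<Rightarrow> nat \<Rightarrow> real) measure" where
  "matM n p = PiM {..<n} (\<lambda>_. vecM p)"

definition noiseM :: "nat \<Rightarrow> (nat \<Rightarrow> real) measure" where
  "noiseM n = PiM {..<n} (\<lambda>_. density lborel std_normal_density)"

definition obsM :: "nat \<Rightarrow> nat \<Rightarrow> ((nat \<Rightarrow> real) \<times> (nat \<Rightarrow> nat \<Rightarrow> real)) measure" where
  "obsM n p = vecM n \<Otimes>\<^sub>M matM n p"

definition response :: "nat \<Rightarrow> nat \<Rightarrow> (nat \<Rightarrow> nat \<Rightarrow> real) \<Rightarrow> (nat \<Rightarrow> real) \<Rightarrow> (nat \<Rightarrow> real) \<Rightarrow> (nat \<Rightarrow> real)" where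
  "response n p X \<beta> e = (\<lambda>i\<in>{..<n}. (\<Sum>j<p. X i j * \<beta> j) + e i)"

definition Exp :: "nat \<Rightarrow> nat \<Rightarrow> (nat \<Rightarrow> nat \<Rightarrow> real) measure \<Rightarrow> (nat \<Rightarrow> real)
    \<Rightarrow> ((nat \<Rightarrow> real) \<times> (nat \<Rightarrow> nat \<Rightarrow> real) \<Rightarrow> real) \<Rightarrow> real" where
  "Exp n p DX \<beta> T = (\<integral>\<omega>. T (response n p (fst \<omega>) \<beta> (snd \<omega>), fst \<omega>) \<partial>(DX \<Otimes>\<^sub>M noiseM n))"

definition tests :: "nat \<Rightarrow> nat \<Rightarrow> ((nat \<Rightarrow> real) \<times> (nat \<Rightarrow> nat \<Rightarrow> real) \<Rightarrow> real) set" where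
  "tests n p = {T \<in> borel_measurable (obsM n p). \<forall>\<omega>\<in>space (obsM n p). 0 \<le> T \<omega> \<and> T \<omega> \<le> 1}"

definition Xi :: "nat \<Rightarrow> nat \<Rightarrow> real \<Rightarrow> (nat \<Rightarrow> real) set" where
  "Xi p s A = {\<beta>. (\<forall>i\<ge>p. \<beta> i = 0) \<and> card {i. \<beta> i \<noteq> 0} = s \<and> (\<forall>i. \<beta> i \<noteq> 0 \<longrightarrow> \<bar>\<beta> i\<bar> \<ge> A)}"

definition risk_test :: "nat \<Rightarrow> nat \<Rightarrow> (nat \<Rightarrow> nat \<Rightarrow> real) measure \<Rightarrow> nat \<Rightarrow> real
    \<Rightarrow> ((nat \<Rightarrow> real) \<times> (nat \<Rightarrow> nat \<Rightarrow> real) \<Rightarrow> real) \<Rightarrow> real" where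
  "risk_test n p DX s A T = Exp n p DX (\<lambda>_. 0) T + (SUP \<beta>\<in>Xi p s A. Exp n p DX \<beta> (\<lambda>\<omega>. 1 - T \<omega>))"

definition minimax_risk :: "nat \<Rightarrow> nat \<Rightarrow> (nat \<Rightarrow> nat \<Rightarrow> real) measure \<Rightarrow> nat \<Rightarrow> real \<Rightarrow> real" where
  "minimax_risk n p DX s A = (INF T\<in>tests n p. risk_test n p DX s A T)"

definition subG_row :: "nat \<Rightarrow> real \<Rightarrow> (nat \<Rightarrow> real) measure \<Rightarrow> bool" where
  "subG_row p \<sigma>2 \<mu> \<longleftrightarrow> prob_space \<mu> \<and> sets \<mu> = sets (vecM p) \<and>
     (\<forall>j<p. integrable \<mu> (\<lambda>x. x j) \<and> (\<integral>x. x j \<partial>\<mu>) = 0) \<and>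
     (\<forall>j<p. \<forall>k<p. integrable \<mu> (\<lambda>x. x j * x k) \<and>
        (\<integral>x. x j * x k \<partial>\<mu>) = (if j = k then 1 else 0)) \<and>
     (\<forall>u::nat \<Rightarrow> real. (\<forall>i\<ge>p. u i = 0) \<longrightarrow> (\<Sum>i<p. (u i)\<^sup>2) = 1 \<longrightarrow>
        (\<forall>t::real. integrable \<mu> (\<lambda>x. exp (t * (\<Sum>i<p. u i * x i))) \<and>
           ln (\<integral>x. exp (t * (\<Sum>i<p. u i * x i)) \<partial>\<mu>) \<le> \<sigma>2 * t\<^sup>2 / 2))"

definition posdef_gram :: "nat \<Rightarrow> nat \<Rightarrow> (nat \<Rightarrow> nat \<Rightarrow> real) \<Rightarrow> bool" where
  "posdef_gram n p X \<longleftrightarrow> (\<forall>v::nat \<Rightarrow> real. (\<forall>i\<ge>p. v i = 0) \<longrightarrow> v \<noteq> (\<lambda>_. 0) \<longrightarrow>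
      0 < (\<Sum>i<n. (\<Sum>j<p. X i j * v j)\<^sup>2))"

definition subG_design :: "nat \<Rightarrow> nat \<Rightarrow> real \<Rightarrow> (nat \<Rightarrow> nat \<Rightarrow> real) measure \<Rightarrow> bool" where
  "subG_design n p \<sigma>2 DX \<longleftrightarrow> (\<exists>\<mu>. subG_row p \<sigma>2 \<mu> \<and> DX = PiM {..<n} (\<lambda>_. \<mu>)) \<and>
      (AE X in DX. posdef_gram n p X)"

definition orth_design :: "nat \<Rightarrow> nat \<Rightarrow> (nat \<Rightarrow> nat \<Rightarrow> real) measure \<Rightarrow> bool" where
  "orth_design n p DX \<longleftrightarrow> prob_space DX \<and> sets DX = sets (matM n p) \<and>
      (AE X in DX. \<forall>j<p. \<forall>k<p. (\<Sum>i<n. X i j * X i k) = (if j = k then real n else 0))"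

end

(* Upper bound: reject when some signed s-sparse vector c satisfies <Xc, y> >= s sqrt (2 u n log p).
   A union bound over the p^(alpha s + o(s)) vectors gives type I exponent u - alpha, and the type II
   exponent is (sqrt r - sqrt u)^2; both equal (r - alpha)^2 / (4 r) for
   sqrt u = (r + alpha) / (2 sqrt r).

   Lower bound: compare the null and the uniform prior at signal level r with the intermediate
   mixture at level u. On typical noise, the mixture density at level u exceeds the null density by at
   most a factor exp (s log p (u - alpha + o(1))) (a truncated second moment bound), and, for each
   support, the density at level u exceeds that at level r by at most
   exp (s log p ((sqrt r - sqrt u)^2 + o(1))). So no test has both errors small.

   Both design classes enter only through |X^T X / n - I| <= delta / s entrywise with delta = 1 / log p.
   For sub-Gaussian designs this fails with probability exp (- omega (s log p)), since
   n / s^2 >= p^(2 alpha - o(1)) is much larger than s log p. *)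

theory Submission
  imports Defs "HOL-Real_Asymp.Real_Asymp"
begin

section \<open>Gaussian noise\<close>

text \<open>The risk is itself exponentially small, and this shapes both halves. A second moment
  bound comparing the null directly with level r would show that they cannot be told apart, which is
  false for r > \<alpha>. At the intermediate level, T and 1 - T cannot both be negligible; whatever
  mass they carry is transported, T to the null and 1 - T to level r, each at a multiplicative cost.
  In the upper bound the probability of a bad design is added to the risk, so "with high
  probability" is not enough: it has to be below the target risk. The tolerance \<delta>/s comes
  from s-sparse vectors. Entrywise Gram errors get multiplied by two l1 norms, that is by s^2, which
  leaves \<delta> s against a main term s. So \<delta> has to tend to 0, and slowly, to keep bad
  designs rare. For a fixed design only shifted standard Gaussian noise occurs, so one change of
  measure formula yields the likelihood ratios, the exponential moments and the tails.\<close>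

abbreviation std_normal :: "real measure" where
  "std_normal \<equiv> density lborel std_normal_density"

definition inner_on :: "nat \<Rightarrow> (nat \<Rightarrow> real) \<Rightarrow> (nat \<Rightarrow> real) \<Rightarrow> real" where
  "inner_on n x y = (\<Sum>i<n. x i * y i)"

definition mat_vec :: "nat \<Rightarrow> (nat \<Rightarrow> nat \<Rightarrow> real) \<Rightarrow> (nat \<Rightarrow> real) \<Rightarrow> nat \<Rightarrow> real" where
  "mat_vec p X c i = (\<Sum>j<p. X i j * c j)"

definition shift_on :: "nat \<Rightarrow> (nat \<Rightarrow> real) \<Rightarrow> (nat \<Rightarrow> real) \<Rightarrow> nat \<Rightarrow> real" where
  "shift_on n v e = (\<lambda>i\<in>{..<n}. v i + e i)"

lemma response_eq_shift: "response n p X \<beta> e = shift_on n (mat_vec p X \<beta>) e"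
  by (simp add: response_def shift_on_def mat_vec_def)

lemma prob_space_std_normal: "prob_space std_normal"
  by (rule prob_space_normal_density) simp

lemma prob_space_noiseM: "prob_space (noiseM n)"
  unfolding noiseM_def by (intro prob_space_PiM prob_space_std_normal)

lemma sets_noiseM [measurable_cong]: "sets (noiseM n) = sets (vecM n)"
  unfolding noiseM_def vecM_def by (intro sets_PiM_cong) auto

text \<open>Completing the square: \<open>t * x - t\<^sup>2 / 2\<close> is the logarithm of the
  ratio of the normal densities centred at \<open>t\<close> and at 0. With nonnegative integrals no
  integrability has to be carried along.\<close>

lemma nn_integral_std_normal_shift:
  assumes [measurable]: "h \<in> borel_measurable borel"
  shows "(\<integral>\<^sup>+x. h (t + x) \<partial>std_normal) = (\<integral>\<^sup>+x. h x * ennreal (exp (t * x - t\<^sup>2 / 2)) \<partial>std_normal)"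
proof -
  have d: "normal_density 0 1 (t + x) * exp (t * (t + x) - t\<^sup>2 / 2) = normal_density 0 1 x" for x
    by (simp add: normal_density_def mult_exp_exp) (simp add: field_simps power2_eq_square)
  have "(\<integral>\<^sup>+x. h x * ennreal (exp (t * x - t\<^sup>2 / 2)) \<partial>std_normal)
      = (\<integral>\<^sup>+x. ennreal (normal_density 0 1 x) * (h x * ennreal (exp (t * x - t\<^sup>2 / 2))) \<partial>lborel)"
    by (subst nn_integral_density) auto
  also have "\<dots> = (\<integral>\<^sup>+x. ennreal (normal_density 0 1 (t + x))
      * (h (t + x) * ennreal (exp (t * (t + x) - t\<^sup>2 / 2))) \<partial>lborel)"
    by (subst nn_integral_real_affine[where c=1 and t=t]) auto
  also have "\<dots> = (\<integral>\<^sup>+x. ennreal (normal_density 0 1 x) * h (t + x) \<partial>lborel)"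
  proof (intro nn_integral_cong)
    fix x
    have "ennreal (normal_density 0 1 (t + x)) * (h (t + x) * ennreal (exp (t * (t + x) - t\<^sup>2 / 2)))
       = ennreal (normal_density 0 1 (t + x) * exp (t * (t + x) - t\<^sup>2 / 2)) * h (t + x)"
      by (subst ennreal_mult) (auto simp: mult_ac)
    then show "ennreal (normal_density 0 1 (t + x)) * (h (t + x) * ennreal (exp (t * (t + x) - t\<^sup>2 / 2)))
       = ennreal (normal_density 0 1 x) * h (t + x)" using d[of x] by simp
  qed
  also have "\<dots> = (\<integral>\<^sup>+x. h (t + x) \<partial>std_normal)"
    by (subst nn_integral_density) auto
  finally show ?thesis by simp
qed

text \<open>Fubini peels off one independent coordinate at a time, and the one-dimensional weights
  multiply to the exponential of a sum.\<close>

lemma nn_integral_PiM_std_normal_shift: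
  assumes "finite I" and "h \<in> borel_measurable (PiM I (\<lambda>_. borel))"
  shows "(\<integral>\<^sup>+e. h (\<lambda>i\<in>I. v i + e i) \<partial>PiM I (\<lambda>_. std_normal))
     = (\<integral>\<^sup>+e. h e * ennreal (exp (\<Sum>i\<in>I. v i * e i - (v i)\<^sup>2 / 2)) \<partial>PiM I (\<lambda>_. std_normal))"
  using assms
proof (induction I arbitrary: h rule: finite_induct)
  case empty
  then show ?case by (simp add: PiM_empty nn_integral_count_space_finite restrict_def)
next
  case (insert i I)
  note [measurable] = insert.prems
  interpret N: prob_space std_normal by (rule prob_space_std_normal)
  interpret P: product_sigma_finite "\<lambda>_::'a. std_normal"
    by (rule product_sigma_finite.intro) (rule N.sigma_finite_measure_axioms)
  have [measurable_cong]: "sets (PiM J (\<lambda>_. std_normal)) = sets (PiM J (\<lambda>_::'a. borel))" for J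
    by (intro sets_PiM_cong) auto
  have upd[measurable]: "(\<lambda>(x, y). x(i := y)) \<in> PiM I (\<lambda>_. borel) \<Otimes>\<^sub>M borel \<rightarrow>\<^sub>M PiM (insert i I) (\<lambda>_. borel)"
    using measurable_add_dim[of i I "\<lambda>_. borel"] by simp
  have hm[measurable]: "(\<lambda>(x, y). h (x(i := y))) \<in> borel_measurable (PiM I (\<lambda>_. borel) \<Otimes>\<^sub>M borel)"
    using measurable_compose[OF upd insert.prems] by (simp add: split_beta')
  have hx: "(\<lambda>y. h (x(i := y))) \<in> borel_measurable borel" if "x \<in> extensional I" for x
    using measurable_compose[OF measurable_Pair1'[of x "PiM I (\<lambda>_. borel)" borel] hm] that
    by (simp add: space_PiM PiE_def)
  define H where "H x = (\<integral>\<^sup>+y. h (x(i := y)) * ennreal (exp (v i * y - (v i)\<^sup>2 / 2)) \<partial>std_normal)" for x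
  have H[measurable]: "H \<in> borel_measurable (PiM I (\<lambda>_. borel))"
    unfolding H_def by measurable
  have sh: "(\<lambda>e. \<lambda>j\<in>insert i I. v j + e j) \<in> PiM (insert i I) (\<lambda>_. borel) \<rightarrow>\<^sub>M PiM (insert i I) (\<lambda>_. borel)"
    by (intro measurable_restrict) measurable
  have "(\<integral>\<^sup>+e. h (\<lambda>j\<in>insert i I. v j + e j) \<partial>PiM (insert i I) (\<lambda>_. std_normal))
     = (\<integral>\<^sup>+x. \<integral>\<^sup>+y. h (\<lambda>j\<in>insert i I. v j + (x(i := y)) j) \<partial>std_normal \<partial>PiM I (\<lambda>_. std_normal))"
    using measurable_compose[OF sh insert.prems]
    by (intro P.product_nn_integral_insert insert.hyps) (simp cong: measurable_cong_sets)
  also have "\<dots> = (\<integral>\<^sup>+x. H (\<lambda>j\<in>I. v j + x j) \<partial>PiM I (\<lambda>_. std_normal))"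
  proof (intro nn_integral_cong)
    fix x
    have e: "(\<lambda>j\<in>insert i I. v j + (x(i := y)) j) = (\<lambda>j\<in>I. v j + x j)(i := v i + y)" for y
      using insert.hyps by (auto simp: fun_eq_iff restrict_def)
    show "(\<integral>\<^sup>+y. h (\<lambda>j\<in>insert i I. v j + (x(i := y)) j) \<partial>std_normal) = H (\<lambda>j\<in>I. v j + x j)"
      unfolding e H_def
      by (rule nn_integral_std_normal_shift[where h="\<lambda>y. h ((\<lambda>j\<in>I. v j + x j)(i := y))"], rule hx) auto
  qed
  also have "\<dots> = (\<integral>\<^sup>+x. H x * ennreal (exp (\<Sum>j\<in>I. v j * x j - (v j)\<^sup>2 / 2)) \<partial>PiM I (\<lambda>_. std_normal))"
    by (rule insert.IH) (rule H)
  also have "\<dots> = (\<integral>\<^sup>+x. \<integral>\<^sup>+y. h (x(i := y)) *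
      ennreal (exp (\<Sum>j\<in>insert i I. v j * (x(i := y)) j - (v j)\<^sup>2 / 2)) \<partial>std_normal \<partial>PiM I (\<lambda>_. std_normal))"
  proof (intro nn_integral_cong)
    fix x assume "x \<in> space (PiM I (\<lambda>_. std_normal))"
    then have [measurable]: "(\<lambda>y. h (x(i := y))) \<in> borel_measurable borel"
      by (intro hx) (auto simp: space_PiM PiE_def)
    have s: "(\<Sum>j\<in>insert i I. v j * (x(i := y)) j - (v j)\<^sup>2 / 2)
        = (v i * y - (v i)\<^sup>2 / 2) + (\<Sum>j\<in>I. v j * x j - (v j)\<^sup>2 / 2)" for y
      using insert.hyps by (auto intro!: sum.cong)
    show "H x * ennreal (exp (\<Sum>j\<in>I. v j * x j - (v j)\<^sup>2 / 2)) = (\<integral>\<^sup>+y. h (x(i := y)) *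
      ennreal (exp (\<Sum>j\<in>insert i I. v j * (x(i := y)) j - (v j)\<^sup>2 / 2)) \<partial>std_normal)"
      unfolding H_def s exp_add
      by (subst nn_integral_multc[symmetric]) (auto simp: ennreal_mult mult.assoc)
  qed
  also have "\<dots> = (\<integral>\<^sup>+e. h e * ennreal (exp (\<Sum>j\<in>insert i I. v j * e j - (v j)\<^sup>2 / 2))
      \<partial>PiM (insert i I) (\<lambda>_. std_normal))"
    by (intro P.product_nn_integral_insert[symmetric] insert.hyps) measurable
  finally show ?case .
qed

lemma nn_integral_noiseM_shift:
  assumes "h \<in> borel_measurable (vecM n)"
  shows "(\<integral>\<^sup>+e. h (shift_on n v e) \<partial>noiseM n)
     = (\<integral>\<^sup>+e. h e * ennreal (exp (inner_on n v e - inner_on n v v / 2)) \<partial>noiseM n)"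
  using nn_integral_PiM_std_normal_shift[of "{..<n}" h v] assms
  by (simp add: shift_on_def noiseM_def vecM_def inner_on_def sum_subtractf power2_eq_square sum_divide_distrib)

lemma measurable_shift_on [measurable]: "shift_on n v \<in> vecM n \<rightarrow>\<^sub>M vecM n"
  unfolding shift_on_def vecM_def by (intro measurable_restrict) measurable

lemma measurable_inner_on [measurable]: "inner_on n v \<in> borel_measurable (vecM n)"
  unfolding inner_on_def vecM_def by measurable

text \<open>The shift formula with constant integrand 1: the weight has total mass 1.\<close>

lemma nn_integral_exp_inner_noiseM:
  "(\<integral>\<^sup>+e. ennreal (exp (inner_on n v e)) \<partial>noiseM n) = ennreal (exp (inner_on n v v / 2))"
proof -
  interpret prob_space "noiseM n" by (rule prob_space_noiseM)
  have "1 = (\<integral>\<^sup>+e. ennreal (exp (inner_on n v e - inner_on n v v / 2)) \<partial>noiseM n)"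
    using nn_integral_noiseM_shift[of "\<lambda>_. 1" n v] emeasure_space_1 by simp
  then have "ennreal (exp (inner_on n v v / 2)) * 1 = (\<integral>\<^sup>+e. ennreal (exp (inner_on n v v / 2)) *
     ennreal (exp (inner_on n v e - inner_on n v v / 2)) \<partial>noiseM n)"
    by (subst nn_integral_cmult) auto
  then show ?thesis by (simp add: ennreal_mult[symmetric] mult_exp_exp)
qed

lemma inner_on_scale: "inner_on n (\<lambda>i. c * v i) w = c * inner_on n v w"
  "inner_on n v (\<lambda>i. c * w i) = c * inner_on n v w"
  by (simp_all add: inner_on_def sum_distrib_left mult_ac)

lemma nn_integral_exp_scaled_inner_noiseM:
  "(\<integral>\<^sup>+e. ennreal (exp (c * inner_on n v e)) \<partial>noiseM n) = ennreal (exp (c\<^sup>2 * inner_on n v v / 2))"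
  using nn_integral_exp_inner_noiseM[of n "\<lambda>i. c * v i"]
  by (simp add: inner_on_scale power2_eq_square mult.assoc)

lemma inner_on_add: "inner_on n (\<lambda>i. v i + v' i) w = inner_on n v w + inner_on n v' w"
  by (simp add: inner_on_def sum.distrib distrib_right)

lemma inner_on_shift: "inner_on n w (shift_on n v e) = inner_on n w v + inner_on n w e"
  by (simp add: inner_on_def shift_on_def sum.distrib algebra_simps)

text \<open>Chernoff bound. Since \<open>q\<close> only bounds the squared norm, one estimate serves
  all directions that a nearly orthogonal design produces.\<close>

lemma noiseM_tail:
  assumes q: "inner_on n v v \<le> q" "0 < q" and t: "0 \<le> t"
  shows "measure (noiseM n) {e \<in> space (noiseM n). t \<le> inner_on n v e} \<le> exp (- t\<^sup>2 / (2 * q))"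
proof -
  interpret prob_space "noiseM n" by (rule prob_space_noiseM)
  \<comment> \<open>The minimiser of \<open>- l * t + l\<^sup>2 * q / 2\<close>.\<close>
  define l where "l = t / q"
  have l: "0 \<le> l" using q t by (simp add: l_def)
  let ?A = "{e \<in> space (noiseM n). t \<le> inner_on n v e}"
  have "ennreal (measure (noiseM n) ?A) = (\<integral>\<^sup>+e. indicator ?A e \<partial>noiseM n)"
    by (subst nn_integral_indicator) (auto simp: emeasure_eq_measure)
  also have "\<dots> \<le> (\<integral>\<^sup>+e. ennreal (exp (- l * t)) * ennreal (exp (inner_on n (\<lambda>i. l * v i) e)) \<partial>noiseM n)"
  proof (intro nn_integral_mono)
    fix e
    have "1 \<le> exp (- l * t) * exp (inner_on n (\<lambda>i. l * v i) e)" if "t \<le> inner_on n v e"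
      using mult_left_mono[OF that l] by (simp add: mult_exp_exp inner_on_scale)
    then show "indicator ?A e \<le> ennreal (exp (- l * t)) * ennreal (exp (inner_on n (\<lambda>i. l * v i) e))"
      by (auto simp: indicator_def ennreal_mult[symmetric] simp flip: ennreal_1 intro!: ennreal_leI)
  qed
  also have "\<dots> = ennreal (exp (- l * t)) * ennreal (exp (inner_on n (\<lambda>i. l * v i) (\<lambda>i. l * v i) / 2))"
    by (subst nn_integral_cmult) (auto simp: nn_integral_exp_inner_noiseM)
  also have "\<dots> = ennreal (exp (- l * t + l\<^sup>2 * inner_on n v v / 2))"
    by (simp add: ennreal_mult[symmetric] mult_exp_exp inner_on_scale power2_eq_square)
  also have "\<dots> \<le> ennreal (exp (- t\<^sup>2 / (2 * q)))"
  proof (intro ennreal_leI)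
    have "l\<^sup>2 * inner_on n v v \<le> l\<^sup>2 * q" using q by (intro mult_left_mono) auto
    also have "l\<^sup>2 * q = t\<^sup>2 / q" using q by (simp add: l_def power2_eq_square)
    finally have "l\<^sup>2 * inner_on n v v / 2 \<le> l * t - t\<^sup>2 / (2 * q)"
      using q by (simp add: l_def power2_eq_square field_simps)
    then show "exp (- l * t + l\<^sup>2 * inner_on n v v / 2) \<le> exp (- t\<^sup>2 / (2 * q))"
      by simp
  qed
  finally show ?thesis by (simp add: ennreal_le_iff)
qed

section \<open>Nearly orthogonal designs and subsets of fixed size\<close>

definition near_orth :: "nat \<Rightarrow> nat \<Rightarrow> real \<Rightarrow> (nat \<Rightarrow> nat \<Rightarrow> real) \<Rightarrow> bool" where
  "near_orth n p d X \<longleftrightarrow>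
     (\<forall>j<p. \<forall>k<p. \<bar>(\<Sum>i<n. X i j * X i k) - (if j = k then real n else 0)\<bar> \<le> real n * d)"

text \<open>The difference is the bilinear form of \<open>X^T X - n I\<close> in \<open>c\<close>
  and \<open>b\<close>, whose entries are at most \<open>n * d\<close>. The l1 norms are kept: they
  equal \<open>s\<close> for sign vectors and stay comparable with the signal for an arbitrary
  coefficient vector.\<close>

lemma near_orth_gram:
  assumes "near_orth n p d X"
  shows "\<bar>inner_on n (mat_vec p X c) (mat_vec p X b) - real n * (\<Sum>j<p. c j * b j)\<bar>
           \<le> real n * d * (\<Sum>j<p. \<bar>c j\<bar>) * (\<Sum>j<p. \<bar>b j\<bar>)"
proof -
  define D where "D j k = (if j = k then real n else 0)" for j k :: nat
  have "inner_on n (mat_vec p X c) (mat_vec p X b)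
      = (\<Sum>i<n. \<Sum>j<p. \<Sum>k<p. X i j * X i k * (c j * b k))"
    unfolding inner_on_def mat_vec_def sum_product by (intro sum.cong refl) (simp only: mult_ac)
  also have "\<dots> = (\<Sum>j<p. \<Sum>k<p. (\<Sum>i<n. X i j * X i k) * (c j * b k))"
    by (subst sum.swap, rule sum.cong[OF refl], subst sum.swap) (simp add: sum_distrib_right)
  finally have 1: "inner_on n (mat_vec p X c) (mat_vec p X b)
      = (\<Sum>j<p. \<Sum>k<p. (\<Sum>i<n. X i j * X i k) * (c j * b k))" .
  have "real n * (\<Sum>j<p. c j * b j) = (\<Sum>j<p. \<Sum>k<p. D j k * (c j * b k))"
    unfolding sum_distrib_left
  proof (intro sum.cong refl)
    fix j assume "j \<in> {..<p}"
    have "(\<Sum>k<p. D j k * (c j * b k)) = (\<Sum>k<p. if j = k then real n * (c j * b k) else 0)"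
      by (intro sum.cong) (auto simp: D_def)
    also have "\<dots> = real n * (c j * b j)" using \<open>j \<in> {..<p}\<close> by simp
    finally show "real n * (c j * b j) = (\<Sum>k<p. D j k * (c j * b k))" by simp
  qed
  then have "inner_on n (mat_vec p X c) (mat_vec p X b) - real n * (\<Sum>j<p. c j * b j)
      = (\<Sum>j<p. \<Sum>k<p. ((\<Sum>i<n. X i j * X i k) - D j k) * (c j * b k))"
    by (simp add: 1 left_diff_distrib sum_subtractf)
  also have "\<bar>\<dots>\<bar> \<le> (\<Sum>j<p. \<Sum>k<p. \<bar>((\<Sum>i<n. X i j * X i k) - D j k) * (c j * b k)\<bar>)"
    by (rule order_trans[OF sum_abs sum_mono[OF sum_abs]])
  also have "\<dots> \<le> (\<Sum>j<p. \<Sum>k<p. (real n * d) * (\<bar>c j\<bar> * \<bar>b k\<bar>))"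
  proof (intro sum_mono)
    fix j k assume "j \<in> {..<p}" "k \<in> {..<p}"
    then have "\<bar>(\<Sum>i<n. X i j * X i k) - D j k\<bar> \<le> real n * d"
      using assms by (simp add: near_orth_def D_def)
    then show "\<bar>((\<Sum>i<n. X i j * X i k) - D j k) * (c j * b k)\<bar> \<le> (real n * d) * (\<bar>c j\<bar> * \<bar>b k\<bar>)"
      unfolding abs_mult by (intro mult_right_mono) auto
  qed
  also have "\<dots> = real n * d * ((\<Sum>j<p. \<bar>c j\<bar>) * (\<Sum>j<p. \<bar>b j\<bar>))"
    unfolding sum_product by (simp only: sum_distrib_left)
  finally show ?thesis by (simp add: mult_ac)
qed

section \<open>Counting subsets of fixed size\<close>

definition subsets_of_size :: "nat \<Rightarrow> nat \<Rightarrow> nat set set" where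
  "subsets_of_size p s = {S. S \<subseteq> {..<p} \<and> card S = s}"

lemma finite_subsets_of_size: "finite (subsets_of_size p s)"
  unfolding subsets_of_size_def by (rule finite_subset[of _ "Pow {..<p}"]) auto

lemma card_subsets_of_size: "card (subsets_of_size p s) = p choose s"
  unfolding subsets_of_size_def using n_subsets[of "{..<p}" s] by simp

lemma card_supersets_of_size:
  assumes "K \<subseteq> {..<p}" "card K \<le> s"
  shows "card {S \<in> subsets_of_size p s. K \<subseteq> S} = (p - card K) choose (s - card K)"
proof -
  have fK: "finite K" using assms finite_subset by blast
  have fin: "finite S" if "S \<subseteq> {..<p}" for S using that finite_subset by blast
  have "bij_betw (\<lambda>S. S - K) {S \<in> subsets_of_size p s. K \<subseteq> S}
      {S. S \<subseteq> {..<p} - K \<and> card S = s - card K}"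
  proof (rule bij_betw_byWitness[where f'="\<lambda>S. S \<union> K"])
    show "(\<lambda>S. S - K) ` {S \<in> subsets_of_size p s. K \<subseteq> S} \<subseteq> {S. S \<subseteq> {..<p} - K \<and> card S = s - card K}"
      using fK by (auto simp: subsets_of_size_def card_Diff_subset)
    show "(\<lambda>S. S \<union> K) ` {S. S \<subseteq> {..<p} - K \<and> card S = s - card K} \<subseteq> {S \<in> subsets_of_size p s. K \<subseteq> S}"
    proof clarify
      fix S assume S: "S \<subseteq> {..<p} - K" "card S = s - card K"
      then have "S \<inter> K = {}" "finite S" by (auto intro: fin)
      then have "card (S \<union> K) = s" using S fK assms by (simp add: card_Un_disjoint)
      then show "S \<union> K \<in> subsets_of_size p s \<and> K \<subseteq> S \<union> K"
        using S assms by (auto simp: subsets_of_size_def)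
    qed
  qed auto
  then have "card {S \<in> subsets_of_size p s. K \<subseteq> S} = card {S. S \<subseteq> {..<p} - K \<and> card S = s - card K}"
    by (rule bij_betw_same_card)
  also have "\<dots> = (p - card K) choose (s - card K)"
    using n_subsets[of "{..<p} - K" "s - card K"] assms fK by (simp add: card_Diff_subset)
  finally show ?thesis .
qed

text \<open>The quotient of the two binomials is the product of \<open>(s - i) / (p - i)\<close>
  over \<open>i < k\<close>, and each factor is at most \<open>s / p\<close> because
  \<open>s \<le> p\<close>. Multiplied out to stay in the natural numbers.\<close>

lemma choose_diff_le:
  assumes "k \<le> s" "s \<le> p"
  shows "((p - k) choose (s - k)) * p ^ k \<le> s ^ k * (p choose s)"
  using assms(1)
proof (induction k)
  case (Suc k)
  define a b where "a = p - Suc k" and "b = s - Suc k"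
  have ab: "p - k = Suc a" "s - k = Suc b" using Suc.prems assms(2) by (auto simp: a_def b_def)
  have le: "Suc b * p \<le> s * Suc a"
    using assms(2) Suc.prems unfolding ab[symmetric] by (simp add: diff_mult_distrib diff_mult_distrib2 mult.commute diff_le_mono2)
  have "Suc a * ((a choose b) * p ^ Suc k) = (Suc b * p) * (((p - k) choose (s - k)) * p ^ k)"
  proof -
    have "Suc a * ((a choose b) * p ^ Suc k) = (Suc a * (a choose b)) * (p * p ^ k)"
      by (simp only: power_Suc mult_ac)
    also have "\<dots> = (Suc b * (Suc a choose Suc b)) * (p * p ^ k)"
      by (simp only: Suc_times_binomial)
    finally show ?thesis unfolding ab by (simp only: mult_ac)
  qed
  also have "\<dots> \<le> (s * Suc a) * (s ^ k * (p choose s))"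
    using Suc by (intro mult_le_mono[OF le]) simp
  also have "\<dots> = Suc a * (s ^ Suc k * (p choose s))"
    by (simp only: power_Suc mult_ac)
  finally have "Suc a * ((a choose b) * p ^ Suc k) \<le> Suc a * (s ^ Suc k * (p choose s))" .
  then show ?case unfolding a_def b_def by (metis Suc_mult_le_cancel1)
qed simp

text \<open>Expansion of \<open>((x - 1) + 1) ^ card W\<close>, indexed by subsets, so that for
  \<open>W = S \<inter> S'\<close> the sum over \<open>K\<close> can be exchanged with a sum over
  \<open>S'\<close>.\<close>

lemma power_card_eq_sum_Pow:
  fixes x :: real
  assumes "finite W"
  shows "x ^ card W = (\<Sum>K\<in>Pow W. (x - 1) ^ card K)"
  using prod_add[OF assms, of "\<lambda>_. x - 1" "\<lambda>_. 1"] by simp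

text \<open>For \<open>S'\<close> uniform among the \<open>s\<close>-subsets, \<open>|S \<inter> S'|\<close> is hypergeometric; its generating
  function is dominated by the binomial one with success probability \<open>s / p\<close>.\<close>

lemma sum_power_card_Int_le:
  assumes x: "1 \<le> x" and S: "S \<in> subsets_of_size p s" and p: "0 < p"
  shows "(\<Sum>S'\<in>subsets_of_size p s. x ^ card (S \<inter> S'))
     \<le> real (p choose s) * (1 + (x - 1) * real s / real p) ^ s"
proof -
  have fS: "finite S" and cS: "card S = s" and Sp: "S \<subseteq> {..<p}"
    using S finite_subset by (auto simp: subsets_of_size_def)
  have sp: "s \<le> p" using card_mono[OF _ Sp] cS by simp
  let ?F = "subsets_of_size p s"
  have "(\<Sum>S'\<in>?F. x ^ card (S \<inter> S')) = (\<Sum>S'\<in>?F. \<Sum>K\<in>Pow S. if K \<subseteq> S' then (x - 1) ^ card K else 0)"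
  proof (intro sum.cong refl)
    fix S'
    have "x ^ card (S \<inter> S') = (\<Sum>K\<in>Pow (S \<inter> S'). (x - 1) ^ card K)"
      using fS by (intro power_card_eq_sum_Pow) auto
    also have "\<dots> = (\<Sum>K\<in>Pow S. if K \<subseteq> S' then (x - 1) ^ card K else 0)"
      using fS by (intro sum.mono_neutral_cong_left) auto
    finally show "x ^ card (S \<inter> S') = (\<Sum>K\<in>Pow S. if K \<subseteq> S' then (x - 1) ^ card K else 0)" .
  qed
  also have "\<dots> = (\<Sum>K\<in>Pow S. \<Sum>S'\<in>?F. if K \<subseteq> S' then (x - 1) ^ card K else 0)"
    by (rule sum.swap)
  also have "\<dots> = (\<Sum>K\<in>Pow S. real (card {S'\<in>?F. K \<subseteq> S'}) * (x - 1) ^ card K)"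
    by (intro sum.cong refl, subst sum.inter_filter[symmetric]) (auto simp: finite_subsets_of_size)
  \<comment> \<open>\<open>1 \<le> x\<close> makes the weights \<open>(x - 1) ^ card K\<close>
    nonnegative, so the hypergeometric probability that \<open>S'\<close> contains \<open>K\<close>
    may be replaced by \<open>(s / p) ^ card K\<close> term by term; the expansion is then folded
    back.\<close>
  also have "\<dots> \<le> (\<Sum>K\<in>Pow S. real (p choose s) * ((1 + (x - 1) * real s / real p) - 1) ^ card K)"
  proof (intro sum_mono)
    fix K assume K: "K \<in> Pow S"
    then have k: "card K \<le> s" using card_mono[OF fS, of K] cS by auto
    have "real (((p - card K) choose (s - card K)) * p ^ card K) \<le> real (s ^ card K * (p choose s))"
      using choose_diff_le[OF k sp] by (simp only: of_nat_le_iff)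
    then have "real ((p - card K) choose (s - card K)) \<le> real (p choose s) * (real s / real p) ^ card K"
      using p by (simp add: power_divide field_simps)
    then have "real (card {S'\<in>?F. K \<subseteq> S'}) * (x - 1) ^ card K
        \<le> real (p choose s) * (real s / real p) ^ card K * (x - 1) ^ card K"
      using x K Sp k by (subst card_supersets_of_size) (auto intro!: mult_right_mono)
    then show "real (card {S'\<in>?F. K \<subseteq> S'}) * (x - 1) ^ card K
        \<le> real (p choose s) * ((1 + (x - 1) * real s / real p) - 1) ^ card K"
      by (simp add: power_mult_distrib power_divide mult_ac)
  qed
  also have "\<dots> = real (p choose s) * (1 + (x - 1) * real s / real p) ^ s"
    unfolding sum_distrib_left[symmetric] by (subst power_card_eq_sum_Pow[OF fS, symmetric]) (simp add: cS)
  finally show ?thesis .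
qed

lemma power_div_fact_le_exp:
  assumes "0 \<le> (x::real)"
  shows "x ^ k / fact k \<le> exp x"
proof -
  have s: "summable (\<lambda>n. x ^ n / fact n)"
    using summable_exp[of x] by (simp add: field_simps)
  have "(\<Sum>n\<in>{k}. x ^ n / fact n) \<le> (\<Sum>n. x ^ n / fact n)"
    using assms s by (intro sum_le_suminf) auto
  also have "\<dots> = exp x" by (simp add: exp_def divide_inverse mult.commute)
  finally show ?thesis by simp
qed

text \<open>Combines \<open>p choose s \<le> p^s / s!\<close> with
  \<open>s^s / s! \<le> e^s\<close>, the latter because one term of the exponential series is at
  most its sum.\<close>

lemma choose_le_exp_power:
  assumes "0 < s"
  shows "real (p choose s) \<le> (exp 1 * real p / real s) ^ s"
proof -
  have "real ((p choose s) * fact s) \<le> real (p ^ s)"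
    using binomial_fact_pow[of p s] by (simp only: of_nat_le_iff)
  then have 1: "real (p choose s) \<le> real p ^ s / fact s" by (simp add: field_simps)
  have "real s ^ s \<le> exp (real s) * fact s"
    using power_div_fact_le_exp[of "real s" s] by (simp add: field_simps)
  then have "real p ^ s / fact s \<le> exp (real s) * real p ^ s / real s ^ s"
    using assms mult_left_mono[of "real s ^ s" "exp (real s) * fact s" "real p ^ s"] by (simp add: field_simps)
  also have "\<dots> = (exp 1 * real p / real s) ^ s"
    by (simp add: power_divide power_mult_distrib exp_of_nat_mult[symmetric])
  finally show ?thesis using 1 by simp
qed

section \<open>Lower bound for a fixed design\<close>

abbreviation col_sum :: "nat \<Rightarrow> (nat \<Rightarrow> nat \<Rightarrow> real) \<Rightarrow> nat set \<Rightarrow> nat \<Rightarrow> real" where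
  "col_sum p X S \<equiv> mat_vec p X (indicator S)"

lemma shift_on_shift_on: "shift_on n u (shift_on n v e) = shift_on n (\<lambda>i. u i + v i) e"
  by (auto simp: shift_on_def fun_eq_iff)

lemma sum_indicator_lessThan:
  assumes "S \<subseteq> {..<p::nat}"
  shows "(\<Sum>j<p. indicator S j) = real (card S)"
proof -
  have "{..<p} \<inter> S = S" using assms by auto
  then show ?thesis by (simp add: indicator_def sum.If_cases if_distrib)
qed

text \<open>Both l1 norms are at most \<open>s\<close>, so the radius \<open>\<delta> / s\<close>
  leaves an error that is the fraction \<open>\<delta>\<close> of \<open>n * s\<close>, the
  approximate squared norm of a sum of \<open>s\<close> columns.\<close>

lemma col_sum_inner:
  assumes X: "near_orth n p (\<delta> / real s) X" and "0 \<le> \<delta>" "0 < s"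
    and S: "S \<subseteq> {..<p}" "S' \<subseteq> {..<p}" "card S \<le> s" "card S' \<le> s"
  shows "\<bar>inner_on n (col_sum p X S) (col_sum p X S') - real n * real (card (S \<inter> S'))\<bar> \<le> real n * \<delta> * real s"
proof -
  have 1: "(\<Sum>j<p. indicator S j * indicator S' j) = real (card (S \<inter> S'))"
    using sum_indicator_lessThan[of "S \<inter> S'" p] S by (subst indicator_inter_arith[symmetric]) auto
  have "\<bar>inner_on n (col_sum p X S) (col_sum p X S') - real n * real (card (S \<inter> S'))\<bar>
     \<le> real n * (\<delta> / real s) * real (card S) * real (card S')"
    using near_orth_gram[OF X, of "indicator S" "indicator S'"] S
    by (simp add: 1 sum_indicator_lessThan)
  also have "\<dots> \<le> real n * (\<delta> / real s) * real s * real s"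
    using S \<open>0 \<le> \<delta>\<close> by (intro mult_mono) auto
  finally show ?thesis using \<open>0 < s\<close> by simp
qed

lemma col_sum_Un:
  assumes "S \<inter> S' = {}"
  shows "col_sum p X (S \<union> S') i = col_sum p X S i + col_sum p X S' i"
  using indicator_add[OF assms, where 'b=real]
  by (simp only: mat_vec_def sum.distrib[symmetric] distrib_left[symmetric])

lemma inner_on_col_sum:
  assumes "S \<subseteq> {..<p}"
  shows "inner_on n (col_sum p X S) e = (\<Sum>j\<in>S. inner_on n (\<lambda>i. X i j) e)"
proof -
  have "inner_on n (col_sum p X S) e = (\<Sum>j<p. indicator S j * inner_on n (\<lambda>i. X i j) e)"
    unfolding inner_on_def mat_vec_def sum_distrib_right sum_distrib_left
    by (subst sum.swap) (simp add: mult_ac)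
  also have "\<dots> = (\<Sum>j\<in>S. inner_on n (\<lambda>i. X i j) e)"
    using assms by (intro sum.mono_neutral_cong_right) (auto simp: indicator_def)
  finally show ?thesis .
qed

lemma abs_le_exp_add_exp: "\<bar>x\<bar> \<le> exp x + exp (- x :: real)"
  using exp_ge_add_one_self[of x] exp_ge_add_one_self[of "- x"] exp_gt_zero[of x] exp_gt_zero[of "-x"]
  by linarith

text \<open>Markov's inequality for the sum of exponentials of plus and minus the normalised column
  products. Each column contributes at most 6 in mean, and 24 is 4 times that. At signal strength of
  order \<open>sqrt (ln p / n)\<close>, noise of order \<open>s * sqrt n\<close> costs only order
  \<open>s * sqrt (ln p)\<close> in the exponent.\<close>

lemma sum_abs_col_tail:
  assumes X: "near_orth n p (\<delta> / real s) X" and \<delta>: "0 \<le> \<delta>" "\<delta> \<le> 1" and s: "0 < s" and n: "0 < n"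
    and S: "S \<in> subsets_of_size p s"
  shows "measure (noiseM n) {e \<in> space (noiseM n).
           24 * real s * sqrt n < (\<Sum>j\<in>S. \<bar>inner_on n (\<lambda>i. X i j) e\<bar>)} \<le> 1 / 4"
    (is "measure _ ?A \<le> _")
proof -
  interpret prob_space "noiseM n" by (rule prob_space_noiseM)
  have Sp: "S \<subseteq> {..<p}" "card S = s" using S by (auto simp: subsets_of_size_def)
  define u where "u j i = (1 / sqrt n) * X i j" for j i :: nat
  have u: "inner_on n (\<lambda>i. X i j) e = sqrt n * inner_on n (u j) e" for j e
    using n unfolding u_def by (simp only: inner_on_scale) simp
  have uu: "inner_on n (u j) (u j) \<le> 2" if "j \<in> S" for j
  proof -
    have "j < p" using that Sp by auto
    then have "\<bar>(\<Sum>i<n. X i j * X i j) - (if j = j then real n else 0)\<bar> \<le> real n * (\<delta> / real s)"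
      using X unfolding near_orth_def by blast
    then have "\<bar>(\<Sum>i<n. X i j * X i j) - real n\<bar> \<le> real n * (\<delta> / real s)" by simp
    also have "\<dots> \<le> real n * 1" using \<delta> s by (intro mult_left_mono) (auto simp: field_simps)
    finally have "inner_on n (\<lambda>i. X i j) (\<lambda>i. X i j) \<le> 2 * real n" by (simp add: inner_on_def)
    then show ?thesis using n unfolding u_def
      by (simp only: inner_on_scale) (simp add: field_simps)
  qed
  have e1: "exp 1 \<le> (3::real)" using exp_le by simp
  have int: "(\<integral>\<^sup>+e. ennreal (exp (inner_on n (u j) e) + exp (- inner_on n (u j) e)) \<partial>noiseM n) \<le> 6"
    if "j \<in> S" for j
  proof -
    have "(\<integral>\<^sup>+e. ennreal (exp (inner_on n (u j) e) + exp (- inner_on n (u j) e)) \<partial>noiseM n)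
      = (\<integral>\<^sup>+e. ennreal (exp (1 * inner_on n (u j) e)) + ennreal (exp ((- 1) * inner_on n (u j) e)) \<partial>noiseM n)"
      by (intro nn_integral_cong) simp
    also have "\<dots> = ennreal (exp (inner_on n (u j) (u j) / 2)) + ennreal (exp (inner_on n (u j) (u j) / 2))"
      by (subst nn_integral_add) (measurable, simp only: nn_integral_exp_scaled_inner_noiseM, simp)
    also have "\<dots> \<le> ennreal 3 + ennreal 3"
      using uu[OF that] e1 by (intro add_mono ennreal_leI) (auto intro: order_trans[OF _ e1])
    also have "\<dots> = 6" by (simp add: ennreal_plus[symmetric] del: ennreal_plus)
    finally show ?thesis .
  qed
  have "ennreal (24 * real s) * emeasure (noiseM n) ?A = (\<integral>\<^sup>+e. ennreal (24 * real s) * indicator ?A e \<partial>noiseM n)"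
    by (subst nn_integral_cmult_indicator) auto
  also have "\<dots> \<le> (\<integral>\<^sup>+e. (\<Sum>j\<in>S. ennreal (exp (inner_on n (u j) e) + exp (- inner_on n (u j) e))) \<partial>noiseM n)"
  proof (intro nn_integral_mono)
    fix e
    have "24 * real s \<le> (\<Sum>j\<in>S. exp (inner_on n (u j) e) + exp (- inner_on n (u j) e))" if "e \<in> ?A"
    proof -
      have "24 * real s * sqrt n < sqrt n * (\<Sum>j\<in>S. \<bar>inner_on n (u j) e\<bar>)"
        using that by (simp add: u abs_mult sum_distrib_left)
      then have "24 * real s < (\<Sum>j\<in>S. \<bar>inner_on n (u j) e\<bar>)" using n by (simp add: mult.commute)
      also have "\<dots> \<le> (\<Sum>j\<in>S. exp (inner_on n (u j) e) + exp (- inner_on n (u j) e))"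
        by (intro sum_mono abs_le_exp_add_exp)
      finally show ?thesis by simp
    qed
    then show "ennreal (24 * real s) * indicator ?A e
      \<le> (\<Sum>j\<in>S. ennreal (exp (inner_on n (u j) e) + exp (- inner_on n (u j) e)))"
      by (subst sum_ennreal) (auto simp: indicator_def intro!: ennreal_leI add_nonneg_nonneg)
  qed
  also have "\<dots> = (\<Sum>j\<in>S. \<integral>\<^sup>+e. ennreal (exp (inner_on n (u j) e) + exp (- inner_on n (u j) e)) \<partial>noiseM n)"
    by (intro nn_integral_sum) auto
  also have "\<dots> \<le> (\<Sum>j\<in>S. 6)" by (intro sum_mono int)
  also have "\<dots> = ennreal (6 * real s)" using Sp by (simp add: ennreal_mult' ennreal_of_nat_eq_real_of_nat mult.commute)
  finally have "ennreal (24 * real s * measure (noiseM n) ?A) \<le> ennreal (6 * real s)"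
    by (simp add: emeasure_eq_measure ennreal_mult')
  then have "24 * real s * measure (noiseM n) ?A \<le> 6 * real s" by (simp add: ennreal_le_iff)
  then show ?thesis using s by (simp add: field_simps)
qed

text \<open>Second moment of the likelihood ratio, truncated to the event where the planted columns
  have moderate noise. Without the truncation the overlap \<open>k\<close> would enter as \<open>exp (a\<^sup>2 n k)\<close>
  instead of \<open>exp (a\<^sup>2 n k / 2)\<close>.\<close>

lemma truncated_moment_le:
  assumes X: "near_orth n p (\<delta> / real s) X" and \<delta>: "0 \<le> \<delta>" and s: "0 < s" and a: "0 \<le> a"
    and S: "S \<in> subsets_of_size p s" and S': "S' \<in> subsets_of_size p s"
  shows "(\<integral>\<^sup>+e. ennreal (exp (inner_on n (\<lambda>i. a * col_sum p X S' i) (shift_on n (\<lambda>i. a * col_sum p X S i) e)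
               - a\<^sup>2 * inner_on n (col_sum p X S') (col_sum p X S') / 2))
            * indicator {e. (\<Sum>j\<in>S. \<bar>inner_on n (\<lambda>i. X i j) e\<bar>) \<le> M} e \<partial>noiseM n)
         \<le> ennreal (exp (a * M + 2 * a\<^sup>2 * n * s * \<delta>) * exp (a\<^sup>2 * n / 2) ^ card (S \<inter> S'))"
proof -
  let ?v = "col_sum p X S" and ?v' = "col_sum p X S'" and ?z = "col_sum p X (S' - S)"
  have Sp: "S \<subseteq> {..<p}" "card S = s" "S' \<subseteq> {..<p}" "card S' = s"
    using S S' by (auto simp: subsets_of_size_def)
  have fin: "finite S" "finite S'" using Sp finite_subset by blast+
  define k where "k = card (S \<inter> S')"
  have cz: "card (S' - S) + k = s" and cz': "card (S' - S) \<le> s"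
    using Sp fin card_Diff_subset_Int[of S' S] card_mono[of S' "S \<inter> S'"]
    by (auto simp: k_def Int_commute)
  have g1: "inner_on n ?v' ?v \<le> n * k + n * \<delta> * s"
    using col_sum_inner[OF X \<delta> s, of S' S] Sp by (auto simp: k_def Int_commute)
  have g2: "inner_on n ?v' ?v' \<ge> real n * s - n * \<delta> * s"
    using col_sum_inner[OF X \<delta> s, of S' S'] Sp by auto
  have g3: "inner_on n ?z ?z \<le> real n * card (S' - S) + n * \<delta> * s"
  proof -
    have "S' - S \<subseteq> {..<p}" using Sp by auto
    from col_sum_inner[OF X \<delta> s this this cz' cz'] show ?thesis by simp
  qed
  \<comment> \<open>The main terms \<open>k - s/2 + (s - k)/2\<close> leave \<open>k/2\<close>; the
    Gram errors enter with weights 1, 1/2 and 1/2, hence the factor 2.\<close>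
  have "real n * card (S' - S) + n * k = real n * s" using cz by (metis distrib_left of_nat_add of_nat_mult)
  with g1 g2 g3 have g: "inner_on n ?v' ?v - inner_on n ?v' ?v' / 2 + inner_on n ?z ?z / 2
      \<le> n * k / 2 + 2 * n * s * \<delta>"
    by (simp add: field_simps)
  define c where "c = a * M + a\<^sup>2 * (inner_on n ?v' ?v - inner_on n ?v' ?v' / 2)"
  \<comment> \<open>The truncation bounds the columns shared with the planted support. Only the
    columns in \<open>S' - S\<close> keep their Gaussian moment, and their squared norm is smaller
    by about \<open>n * k\<close> than that of all of \<open>S'\<close>. This halves the exponent of
    the overlap.\<close>
  have pw: "exp (inner_on n (\<lambda>i. a * ?v' i) (shift_on n (\<lambda>i. a * ?v i) e) - a\<^sup>2 * inner_on n ?v' ?v' / 2)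
      \<le> exp c * exp (inner_on n (\<lambda>i. a * ?z i) e)" if "(\<Sum>j\<in>S. \<bar>inner_on n (\<lambda>i. X i j) e\<bar>) \<le> M" for e
  proof -
    have "S \<inter> S' \<union> (S' - S) = S'" "(S \<inter> S') \<inter> (S' - S) = {}" by auto
    then have "?v' = (\<lambda>i. col_sum p X (S \<inter> S') i + ?z i)"
      using col_sum_Un[of "S \<inter> S'" "S' - S" p X] by (simp add: fun_eq_iff)
    then have "inner_on n ?v' e = inner_on n (col_sum p X (S \<inter> S')) e + inner_on n ?z e"
      by (metis inner_on_add)
    also have "inner_on n (col_sum p X (S \<inter> S')) e = (\<Sum>j\<in>S \<inter> S'. inner_on n (\<lambda>i. X i j) e)"
      using Sp by (intro inner_on_col_sum) auto
    also have "\<dots> \<le> (\<Sum>j\<in>S \<inter> S'. \<bar>inner_on n (\<lambda>i. X i j) e\<bar>)" by (intro sum_mono) auto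
    also have "\<dots> \<le> (\<Sum>j\<in>S. \<bar>inner_on n (\<lambda>i. X i j) e\<bar>)" using fin by (intro sum_mono2) auto
    also note that
    finally have "a * inner_on n ?v' e \<le> a * (M + inner_on n ?z e)" using a by (intro mult_left_mono) auto
    then show ?thesis
      by (simp add: mult_exp_exp c_def inner_on_scale inner_on_shift power2_eq_square algebra_simps)
  qed
  have "(\<integral>\<^sup>+e. ennreal (exp (inner_on n (\<lambda>i. a * ?v' i) (shift_on n (\<lambda>i. a * ?v i) e)
               - a\<^sup>2 * inner_on n ?v' ?v' / 2))
            * indicator {e. (\<Sum>j\<in>S. \<bar>inner_on n (\<lambda>i. X i j) e\<bar>) \<le> M} e \<partial>noiseM n)
     \<le> (\<integral>\<^sup>+e. ennreal (exp c) * ennreal (exp (inner_on n (\<lambda>i. a * ?z i) e)) \<partial>noiseM n)"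
    by (intro nn_integral_mono) (auto simp: indicator_def ennreal_mult[symmetric] intro!: ennreal_leI pw)
  also have "\<dots> = ennreal (exp c * exp (a\<^sup>2 * inner_on n ?z ?z / 2))"
    by (subst nn_integral_cmult)
      (simp_all add: nn_integral_exp_scaled_inner_noiseM inner_on_scale(1) ennreal_mult)
  also have "\<dots> \<le> ennreal (exp (a * M + 2 * a\<^sup>2 * n * s * \<delta>) * exp (a\<^sup>2 * n / 2) ^ k)"
  proof (intro ennreal_leI)
    have "a\<^sup>2 * (inner_on n ?v' ?v - inner_on n ?v' ?v' / 2 + inner_on n ?z ?z / 2)
        \<le> a\<^sup>2 * (n * k / 2 + 2 * n * s * \<delta>)"
      using g by (intro mult_left_mono) auto
    then have "c + a\<^sup>2 * inner_on n ?z ?z / 2 \<le> a * M + 2 * a\<^sup>2 * n * s * \<delta> + k * (a\<^sup>2 * n / 2)"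
      by (simp add: c_def algebra_simps)
    then show "exp c * exp (a\<^sup>2 * inner_on n ?z ?z / 2)
        \<le> exp (a * M + 2 * a\<^sup>2 * n * s * \<delta>) * exp (a\<^sup>2 * n / 2) ^ k"
      by (simp add: mult_exp_exp exp_of_nat_mult[symmetric])
  qed
  finally show ?thesis unfolding k_def .
qed

text \<open>Adding \<open>b * v\<close> to the shift \<open>u\<close> changes the measure by a
  weight that is at least \<open>exp (- K)\<close> as soon as the noise along \<open>v\<close> is
  not below minus two standard deviations, measured by \<open>q\<close>. It is applied to the
  acceptance function \<open>1 - T\<close>.\<close>

lemma shifted_expectation_ge:
  assumes f[measurable]: "f \<in> borel_measurable (vecM n)" and f0: "\<And>y. 0 \<le> f y"
    and q: "inner_on n v v \<le> q" and b: "0 \<le> b"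
    and K: "b * (2 * sqrt q) + b\<^sup>2 * q / 2 \<le> K"
  shows "ennreal (exp (- K)) * (\<integral>\<^sup>+e. ennreal (f (shift_on n u e)) * indicator {e. - (2 * sqrt q) \<le> inner_on n v e} e \<partial>noiseM n)
     \<le> (\<integral>\<^sup>+e. ennreal (f (shift_on n (\<lambda>i. u i + b * v i) e)) \<partial>noiseM n)"
proof -
  have "(\<integral>\<^sup>+e. ennreal (f (shift_on n (\<lambda>i. u i + b * v i) e)) \<partial>noiseM n)
      = (\<integral>\<^sup>+e. ennreal (f (shift_on n u (shift_on n (\<lambda>i. b * v i) e))) \<partial>noiseM n)"
    by (simp add: shift_on_shift_on)
  also have "\<dots> = (\<integral>\<^sup>+e. ennreal (f (shift_on n u e)) *
      ennreal (exp (inner_on n (\<lambda>i. b * v i) e - inner_on n (\<lambda>i. b * v i) (\<lambda>i. b * v i) / 2)) \<partial>noiseM n)"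
    by (rule nn_integral_noiseM_shift[where h="\<lambda>e. ennreal (f (shift_on n u e))"]) measurable
  also have "\<dots> \<ge> (\<integral>\<^sup>+e. ennreal (exp (- K)) * (ennreal (f (shift_on n u e))
      * indicator {e. - (2 * sqrt q) \<le> inner_on n v e} e) \<partial>noiseM n)"
  proof (intro nn_integral_mono)
    fix e
    have "exp (- K) \<le> exp (inner_on n (\<lambda>i. b * v i) e - inner_on n (\<lambda>i. b * v i) (\<lambda>i. b * v i) / 2)"
      if "- (2 * sqrt q) \<le> inner_on n v e"
    proof -
      have "b * (- (2 * sqrt q)) \<le> b * inner_on n v e" using that b by (intro mult_left_mono)
      moreover have "b\<^sup>2 * inner_on n v v \<le> b\<^sup>2 * q" using q by (intro mult_left_mono) auto
      ultimately show ?thesis using K by (simp add: inner_on_scale power2_eq_square)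
    qed
    then show "ennreal (exp (- K)) * (ennreal (f (shift_on n u e)) * indicator {e. - (2 * sqrt q) \<le> inner_on n v e} e)
      \<le> ennreal (f (shift_on n u e)) * ennreal (exp (inner_on n (\<lambda>i. b * v i) e
          - inner_on n (\<lambda>i. b * v i) (\<lambda>i. b * v i) / 2))"
      by (cases "- (2 * sqrt q) \<le> inner_on n v e")
        (simp_all add: mult.commute[of "ennreal (exp (- K))"] mult_left_mono)
  qed
  finally show ?thesis
    by (subst (asm) nn_integral_cmult) auto
qed

text \<open>One \<open>K\<close> bounds both costs. In \<open>K1\<close> it is the shift from level
  \<open>a\<close> to level \<open>A\<close> for a single support. In \<open>K2\<close> it is the
  logarithm of 8 times the averaged truncated moment, with summands for the truncation level, the
  Gram error, the hypergeometric generating function, and the 8 for Markov's inequality.\<close>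

locale lower_bound_setup =
  fixes n p s :: nat and \<delta> a A K :: real and X :: "nat \<Rightarrow> nat \<Rightarrow> real"
  assumes X: "near_orth n p (\<delta> / real s) X"
    and \<delta>: "0 \<le> \<delta>" "\<delta> \<le> 1" and n: "0 < n" and s: "0 < s" "s \<le> p" and a: "0 \<le> a" "a \<le> A"
    and K1: "(A - a) * (2 * sqrt (n * s * (1 + \<delta>))) + (A - a)\<^sup>2 * (n * s * (1 + \<delta>)) / 2 \<le> K"
    and K2: "a * (24 * s * sqrt n) + 2 * a\<^sup>2 * n * s * \<delta>
        + s * ln (1 + (exp (a\<^sup>2 * n / 2) - 1) * s / p) + ln 8 \<le> K"
begin

text \<open>The likelihood ratio itself, not its logarithm: the density of noise shifted by
  \<open>a * col_sum p X S\<close> with respect to unshifted noise.\<close>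

definition llr :: "nat set \<Rightarrow> (nat \<Rightarrow> real) \<Rightarrow> real" where
  "llr S y = exp (inner_on n (\<lambda>i. a * col_sum p X S i) y - a\<^sup>2 * inner_on n (col_sum p X S) (col_sum p X S) / 2)"

definition mixture_lr :: "(nat \<Rightarrow> real) \<Rightarrow> real" where
  "mixture_lr y = (\<Sum>S\<in>subsets_of_size p s. llr S y) / real (p choose s)"

lemma llr_measurable [measurable]: "llr S \<in> borel_measurable (vecM n)"
  unfolding llr_def by measurable

lemma mixture_lr_measurable [measurable]: "mixture_lr \<in> borel_measurable (vecM n)"
  unfolding mixture_lr_def by measurable

lemma llr_nonneg: "0 \<le> llr S y" and mixture_lr_nonneg: "0 \<le> mixture_lr y"
  by (auto simp: llr_def mixture_lr_def intro!: divide_nonneg_nonneg sum_nonneg)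

lemma choose_pos: "0 < real (p choose s)"
  using s by simp

text \<open>Change of measure from the mixture to the null: the weights of the shifts add up to
  \<open>(p choose s) * mixture_lr\<close>, which the indicator caps at \<open>exp K\<close>.
  Working with sums over supports avoids divisions in \<open>ennreal\<close>.\<close>

lemma null_expectation_ge:
  assumes f[measurable]: "f \<in> borel_measurable (vecM n)" and f0: "\<And>y. 0 \<le> f y"
  shows "ennreal (exp (- K)) * (\<Sum>S\<in>subsets_of_size p s. \<integral>\<^sup>+e. ennreal (f (shift_on n (\<lambda>i. a * col_sum p X S i) e))
            * indicator {y. mixture_lr y \<le> exp K} (shift_on n (\<lambda>i. a * col_sum p X S i) e) \<partial>noiseM n)
       \<le> ennreal (real (p choose s)) * (\<integral>\<^sup>+y. ennreal (f y) \<partial>noiseM n)"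
proof -
  let ?h = "\<lambda>y. ennreal (f y) * indicator {y. mixture_lr y \<le> exp K} y"
  have [measurable]: "?h \<in> borel_measurable (vecM n)"
  proof -
    have "?h = (\<lambda>y. if mixture_lr y \<le> exp K then ennreal (f y) else 0)" by (auto simp: indicator_def)
    then show ?thesis by simp
  qed
  have "(\<Sum>S\<in>subsets_of_size p s. \<integral>\<^sup>+e. ?h (shift_on n (\<lambda>i. a * col_sum p X S i) e) \<partial>noiseM n)
      = (\<Sum>S\<in>subsets_of_size p s. \<integral>\<^sup>+y. ?h y * ennreal (llr S y) \<partial>noiseM n)"
    by (intro sum.cong refl, subst nn_integral_noiseM_shift)
       (auto simp: llr_def inner_on_scale power2_eq_square mult.assoc)
  also have "\<dots> = (\<integral>\<^sup>+y. (\<Sum>S\<in>subsets_of_size p s. ?h y * ennreal (llr S y)) \<partial>noiseM n)"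
    by (intro nn_integral_sum[symmetric]) auto
  also have "\<dots> \<le> (\<integral>\<^sup>+y. ennreal (real (p choose s) * exp K) * ennreal (f y) \<partial>noiseM n)"
  proof (intro nn_integral_mono)
    fix y
    have "(\<Sum>S\<in>subsets_of_size p s. ?h y * ennreal (llr S y)) = ?h y * ennreal (\<Sum>S\<in>subsets_of_size p s. llr S y)"
      by (simp add: sum_distrib_left[symmetric] sum_ennreal llr_nonneg)
    also have "(\<Sum>S\<in>subsets_of_size p s. llr S y) = real (p choose s) * mixture_lr y"
      using choose_pos by (simp add: mixture_lr_def)
    also have "?h y * ennreal (real (p choose s) * mixture_lr y) \<le> ennreal (f y) * ennreal (real (p choose s) * exp K)"
      by (auto simp: indicator_def intro!: mult_left_mono ennreal_leI)
    finally show "(\<Sum>S\<in>subsets_of_size p s. ?h y * ennreal (llr S y)) \<le> ennreal (real (p choose s) * exp K) * ennreal (f y)"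
      by (simp add: mult.commute)
  qed
  also have "\<dots> = ennreal (exp K) * (ennreal (real (p choose s)) * (\<integral>\<^sup>+y. ennreal (f y) \<partial>noiseM n))"
    by (subst nn_integral_cmult) (auto simp: ennreal_mult mult_ac)
  finally have "ennreal (exp (- K)) * (\<Sum>S\<in>subsets_of_size p s. \<integral>\<^sup>+e. ?h (shift_on n (\<lambda>i. a * col_sum p X S i) e) \<partial>noiseM n)
      \<le> ennreal (exp (- K)) * (ennreal (exp K) * (ennreal (real (p choose s)) * (\<integral>\<^sup>+y. ennreal (f y) \<partial>noiseM n)))"
    by (intro mult_left_mono) auto
  also have "\<dots> = ennreal (real (p choose s)) * (\<integral>\<^sup>+y. ennreal (f y) \<partial>noiseM n)"
    by (simp add: mult.assoc[symmetric] ennreal_mult[symmetric] mult_exp_exp)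
  finally show ?thesis .
qed

text \<open>Markov's inequality under the planted support: the truncated mean of the mixture ratio
  is an average over \<open>S'\<close> of truncated moments, and averaging
  \<open>x ^ card (S \<inter> S')\<close> gives the hypergeometric generating function.\<close>

lemma mixture_lr_tail:
  assumes S: "S \<in> subsets_of_size p s"
  shows "measure (noiseM n) {e \<in> space (noiseM n). (\<Sum>j\<in>S. \<bar>inner_on n (\<lambda>i. X i j) e\<bar>) \<le> 24 * s * sqrt n \<and>
            exp K < mixture_lr (shift_on n (\<lambda>i. a * col_sum p X S i) e)} \<le> 1 / 8"
    (is "measure _ ?B \<le> _")
proof -
  interpret prob_space "noiseM n" by (rule prob_space_noiseM)
  let ?G = "{e. (\<Sum>j\<in>S. \<bar>inner_on n (\<lambda>i. X i j) e\<bar>) \<le> 24 * s * sqrt n}"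
  let ?L = "\<lambda>S' e. llr S' (shift_on n (\<lambda>i. a * col_sum p X S i) e)"
  define x where "x = exp (a\<^sup>2 * n / 2)"
  define E where "E = exp (a * (24 * s * sqrt n) + 2 * a\<^sup>2 * n * s * \<delta>)"
  define B where "B = (1 + (x - 1) * real s / real p)"
  have x: "1 \<le> x" by (simp add: x_def)
  have p: "0 < p" using s by simp
  have B1: "1 \<le> B" using x p by (simp add: B_def)
  have "ennreal (exp K) * emeasure (noiseM n) ?B = (\<integral>\<^sup>+e. ennreal (exp K) * indicator ?B e \<partial>noiseM n)"
    by (subst nn_integral_cmult_indicator) auto
  also have "\<dots> \<le> (\<integral>\<^sup>+e. (\<Sum>S'\<in>subsets_of_size p s. ennreal (1 / (p choose s)) * (ennreal (?L S' e) * indicator ?G e)) \<partial>noiseM n)"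
  proof (intro nn_integral_mono)
    fix e
    show "ennreal (exp K) * indicator ?B e
      \<le> (\<Sum>S'\<in>subsets_of_size p s. ennreal (1 / (p choose s)) * (ennreal (?L S' e) * indicator ?G e))"
    proof (cases "e \<in> ?B")
      case True
      have "(\<Sum>S'\<in>subsets_of_size p s. ennreal (1 / (p choose s)) * (ennreal (?L S' e) * indicator ?G e))
         = ennreal (1 / (p choose s)) * ennreal (\<Sum>S'\<in>subsets_of_size p s. ?L S' e)"
        using True by (simp add: sum_distrib_left[symmetric] sum_ennreal llr_nonneg)
      also have "\<dots> = ennreal (mixture_lr (shift_on n (\<lambda>i. a * col_sum p X S i) e))"
        by (subst ennreal_mult[symmetric]) (auto simp: mixture_lr_def llr_nonneg sum_nonneg)
      finally show ?thesis using True by (auto intro!: ennreal_leI)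
    qed simp
  qed
  also have "\<dots> = (\<Sum>S'\<in>subsets_of_size p s. ennreal (1 / (p choose s)) * (\<integral>\<^sup>+e. ennreal (?L S' e) * indicator ?G e \<partial>noiseM n))"
  proof -
    have [measurable]: "(\<lambda>e. ennreal (?L S' e) * indicator ?G e) \<in> borel_measurable (noiseM n)" for S'
    proof -
      have "(\<lambda>e. ennreal (?L S' e) * indicator ?G e)
        = (\<lambda>e. if (\<Sum>j\<in>S. \<bar>inner_on n (\<lambda>i. X i j) e\<bar>) \<le> 24 * s * sqrt n then ennreal (?L S' e) else 0)"
        by (auto simp: indicator_def)
      then show ?thesis by simp
    qed
    show ?thesis by (subst nn_integral_sum) (auto simp: nn_integral_cmult)
  qed
  also have "\<dots> \<le> (\<Sum>S'\<in>subsets_of_size p s. ennreal (1 / (p choose s)) * ennreal (E * x ^ card (S \<inter> S')))"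
  proof (intro sum_mono mult_left_mono)
    fix S' assume "S' \<in> subsets_of_size p s"
    from truncated_moment_le[OF X \<delta>(1) s(1) a(1) S this, of "24 * s * sqrt n"]
    show "(\<integral>\<^sup>+e. ennreal (?L S' e) * indicator ?G e \<partial>noiseM n) \<le> ennreal (E * x ^ card (S \<inter> S'))"
      by (simp add: llr_def E_def x_def)
  qed auto
  also have "\<dots> = ennreal (E * ((\<Sum>S'\<in>subsets_of_size p s. x ^ card (S \<inter> S')) / (p choose s)))"
    using x by (simp add: ennreal_mult[symmetric] E_def sum_distrib_left sum_divide_distrib)
  also have "\<dots> \<le> ennreal (E * B ^ s)"
  proof (intro ennreal_leI mult_left_mono)
    show "(\<Sum>S'\<in>subsets_of_size p s. x ^ card (S \<inter> S')) / (p choose s) \<le> B ^ s"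
      using sum_power_card_Int_le[OF x S p] choose_pos by (simp add: B_def field_simps)
  qed (simp add: E_def)
  also have "\<dots> \<le> ennreal (exp K / 8)"
  proof (intro ennreal_leI)
    have "B ^ s = exp (s * ln B)" using B1 by (simp add: exp_of_nat_mult)
    then have "E * B ^ s * 8 = exp (a * (24 * s * sqrt n) + 2 * a\<^sup>2 * n * s * \<delta> + s * ln B + ln 8)"
      by (simp add: E_def exp_add)
    also have "\<dots> \<le> exp K" using K2 by (simp add: B_def x_def)
    finally show "E * B ^ s \<le> exp K / 8" by simp
  qed
  finally have "ennreal (exp K * measure (noiseM n) ?B) \<le> ennreal (exp K / 8)"
    by (simp add: emeasure_eq_measure ennreal_mult')
  then have "exp K * measure (noiseM n) ?B \<le> exp K / 8" by (simp add: ennreal_le_iff)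
  then show ?thesis by simp
qed

text \<open>Union bound over three failures: low noise along the planted direction, large column
  noise, and a large mixture ratio despite moderate column noise. Their probabilities are at most
  1/3, 1/4 and 1/8, which leaves 7/24.\<close>

lemma good_event_prob:
  assumes S: "S \<in> subsets_of_size p s"
  shows "1 / 4 \<le> measure (noiseM n) {e \<in> space (noiseM n). - (2 * sqrt (n * s * (1 + \<delta>))) \<le> inner_on n (col_sum p X S) e
     \<and> mixture_lr (shift_on n (\<lambda>i. a * col_sum p X S i) e) \<le> exp K}" (is "_ \<le> measure _ ?A")
proof -
  interpret prob_space "noiseM n" by (rule prob_space_noiseM)
  let ?q = "n * s * (1 + \<delta>)"
  let ?v = "col_sum p X S"
  have Sp: "S \<subseteq> {..<p}" "card S = s" using S by (auto simp: subsets_of_size_def)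
  have q: "inner_on n ?v ?v \<le> ?q" "0 < ?q"
    using col_sum_inner[OF X \<delta>(1) s(1), of S S] Sp n s \<delta> by (auto simp: algebra_simps add_pos_nonneg)
  let ?B1 = "{e \<in> space (noiseM n). 2 * sqrt ?q \<le> inner_on n (\<lambda>i. (-1) * ?v i) e}"
  let ?B2 = "{e \<in> space (noiseM n). 24 * real s * sqrt n < (\<Sum>j\<in>S. \<bar>inner_on n (\<lambda>i. X i j) e\<bar>)}"
  let ?B3 = "{e \<in> space (noiseM n). (\<Sum>j\<in>S. \<bar>inner_on n (\<lambda>i. X i j) e\<bar>) \<le> 24 * s * sqrt n \<and>
            exp K < mixture_lr (shift_on n (\<lambda>i. a * col_sum p X S i) e)}"
  have "prob ?B1 \<le> exp (- (2 * sqrt ?q)\<^sup>2 / (2 * ?q))"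
    using q by (intro noiseM_tail) (simp_all only: inner_on_scale, auto)
  also have "(2 * sqrt ?q)\<^sup>2 = 4 * ?q" using q by (simp add: power_mult_distrib)
  also have "- (4 * ?q) / (2 * ?q) = - 2"
  proof -
    have "- (4 * z) / (2 * z) = - 2" if "0 < z" for z :: real using that by simp
    then show ?thesis using q(2) by blast
  qed
  finally have b1: "prob ?B1 \<le> exp (- 2)" .
  have "3 \<le> exp (2::real)" using exp_ge_add_one_self[of 2] by simp
  then have "exp (- 2) \<le> (1 / 3 :: real)" by (simp add: exp_minus field_simps)
  with b1 have b1: "prob ?B1 \<le> 1 / 3" by simp
  have b2: "prob ?B2 \<le> 1 / 4" by (rule sum_abs_col_tail[OF X \<delta> s(1) n S])
  have b3: "prob ?B3 \<le> 1 / 8" by (rule mixture_lr_tail[OF S])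
  have "1 = prob (space (noiseM n))" by (simp add: prob_space)
  also have "\<dots> \<le> prob (?A \<union> (?B1 \<union> (?B2 \<union> ?B3)))"
  proof (intro finite_measure_mono subsetI)
    fix e assume "e \<in> space (noiseM n)"
    then show "e \<in> ?A \<union> (?B1 \<union> (?B2 \<union> ?B3))"
      by (simp only: inner_on_scale(1) Un_iff mem_Collect_eq) (simp only: of_nat_mult of_nat_numeral, argo)
  qed measurable
  also have "\<dots> \<le> prob ?A + (prob ?B1 + (prob ?B2 + prob ?B3))"
    by (intro order_trans[OF measure_Un_le] add_mono order_refl) measurable
  finally show ?thesis using b1 b2 b3 by simp
qed

text \<open>On the good event at level \<open>a\<close>, \<open>T\<close> and \<open>1 - T\<close>
  add up to 1, so for each support they carry mass at least 1/4 together. The share of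
  \<open>T\<close> is charged to the null through the mixture, that of \<open>1 - T\<close> to level
  \<open>A\<close> with the same support, each at the price \<open>exp K\<close>.\<close>

lemma fixed_design_lower_bound:
  assumes T[measurable]: "T \<in> borel_measurable (vecM n)" and T01: "\<And>y. 0 \<le> T y" "\<And>y. T y \<le> 1"
  shows "ennreal (real (p choose s) * (exp (- K) / 4))
    \<le> ennreal (real (p choose s)) * (\<integral>\<^sup>+e. ennreal (T e) \<partial>noiseM n)
       + (\<Sum>S\<in>subsets_of_size p s. \<integral>\<^sup>+e. ennreal (1 - T (shift_on n (\<lambda>i. A * col_sum p X S i) e)) \<partial>noiseM n)"
proof -
  interpret prob_space "noiseM n" by (rule prob_space_noiseM)
  let ?q = "n * s * (1 + \<delta>)"
  let ?F = "subsets_of_size p s"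
  let ?sh = "\<lambda>S e. shift_on n (\<lambda>i. a * col_sum p X S i) e"
  let ?I1 = "\<lambda>S. \<integral>\<^sup>+e. ennreal (T (?sh S e)) * indicator {y. mixture_lr y \<le> exp K} (?sh S e) \<partial>noiseM n"
  let ?I2 = "\<lambda>S. \<integral>\<^sup>+e. ennreal (1 - T (?sh S e)) * indicator {e. - (2 * sqrt ?q) \<le> inner_on n (col_sum p X S) e} e \<partial>noiseM n"
  have m1: "(\<lambda>e. ennreal (T (?sh S e)) * indicator {y. mixture_lr y \<le> exp K} (?sh S e)) \<in> borel_measurable (noiseM n)" for S
  proof -
    have "(\<lambda>e. ennreal (T (?sh S e)) * indicator {y. mixture_lr y \<le> exp K} (?sh S e))
       = (\<lambda>e. if mixture_lr (?sh S e) \<le> exp K then ennreal (T (?sh S e)) else 0)" by (auto simp: indicator_def)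
    then show ?thesis by simp
  qed
  have m2: "(\<lambda>e. ennreal (1 - T (?sh S e)) * indicator {e. - (2 * sqrt ?q) \<le> inner_on n (col_sum p X S) e} e) \<in> borel_measurable (noiseM n)" for S
  proof -
    have "(\<lambda>e. ennreal (1 - T (?sh S e)) * indicator {e. - (2 * sqrt ?q) \<le> inner_on n (col_sum p X S) e} e)
      = (\<lambda>e. if - (2 * sqrt ?q) \<le> inner_on n (col_sum p X S) e then ennreal (1 - T (?sh S e)) else 0)" by (auto simp: indicator_def)
    then show ?thesis by simp
  qed
  have both: "ennreal (1 / 4) \<le> ?I1 S + ?I2 S" if S: "S \<in> ?F" for S
  proof -
    let ?A = "{e \<in> space (noiseM n). - (2 * sqrt ?q) \<le> inner_on n (col_sum p X S) e \<and> mixture_lr (?sh S e) \<le> exp K}"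
    have "ennreal (1 / 4) \<le> emeasure (noiseM n) ?A"
      using good_event_prob[OF S] by (simp add: emeasure_eq_measure ennreal_leI)
    also have "\<dots> = (\<integral>\<^sup>+e. indicator ?A e \<partial>noiseM n)" by (subst nn_integral_indicator) auto
    also have "\<dots> \<le> (\<integral>\<^sup>+e. ennreal (T (?sh S e)) * indicator {y. mixture_lr y \<le> exp K} (?sh S e)
        + ennreal (1 - T (?sh S e)) * indicator {e. - (2 * sqrt ?q) \<le> inner_on n (col_sum p X S) e} e \<partial>noiseM n)"
      using T01 by (intro nn_integral_mono) (auto simp: indicator_def ennreal_plus[symmetric] simp del: ennreal_plus)
    also have "\<dots> = ?I1 S + ?I2 S" by (intro nn_integral_add m1 m2)
    finally show ?thesis .
  qed
  have "ennreal (real (p choose s) * (exp (- K) / 4)) = ennreal (exp (- K)) * (\<Sum>S\<in>?F. ennreal (1 / 4))"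
    by (simp add: card_subsets_of_size ennreal_mult'' ennreal_of_nat_eq_real_of_nat flip: ennreal_mult')
  also have "\<dots> \<le> ennreal (exp (- K)) * (\<Sum>S\<in>?F. ?I1 S + ?I2 S)"
    by (intro mult_left_mono sum_mono both) auto
  also have "\<dots> = ennreal (exp (- K)) * (\<Sum>S\<in>?F. ?I1 S) + (\<Sum>S\<in>?F. ennreal (exp (- K)) * ?I2 S)"
    by (simp add: sum.distrib distrib_left sum_distrib_left)
  also have "\<dots> \<le> ennreal (real (p choose s)) * (\<integral>\<^sup>+e. ennreal (T e) \<partial>noiseM n)
       + (\<Sum>S\<in>?F. \<integral>\<^sup>+e. ennreal (1 - T (shift_on n (\<lambda>i. A * col_sum p X S i) e)) \<partial>noiseM n)"
  proof (intro add_mono sum_mono)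
    show "ennreal (exp (- K)) * (\<Sum>S\<in>?F. ?I1 S) \<le> ennreal (real (p choose s)) * (\<integral>\<^sup>+e. ennreal (T e) \<partial>noiseM n)"
      by (rule null_expectation_ge) (auto simp: T01)
    fix S assume S: "S \<in> ?F"
    then have Sp: "S \<subseteq> {..<p}" "card S = s" by (auto simp: subsets_of_size_def)
    have q: "inner_on n (col_sum p X S) (col_sum p X S) \<le> ?q"
      using col_sum_inner[OF X \<delta>(1) s(1), of S S] Sp by (auto simp: algebra_simps)
    have e: "(\<lambda>i. a * col_sum p X S i + (A - a) * col_sum p X S i) = (\<lambda>i. A * col_sum p X S i)"
      by (simp add: algebra_simps)
    have m: "(\<lambda>y. 1 - T y) \<in> borel_measurable (vecM n)" by measurable
    show "ennreal (exp (- K)) * ?I2 S \<le> (\<integral>\<^sup>+e. ennreal (1 - T (shift_on n (\<lambda>i. A * col_sum p X S i) e)) \<partial>noiseM n)"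
      using shifted_expectation_ge[OF m _ q _ K1, of "\<lambda>i. a * col_sum p X S i"] a T01 by (simp add: e)
  qed
  finally show ?thesis .
qed

end

section \<open>Scan test\<close>

definition sign_vectors :: "nat \<Rightarrow> nat \<Rightarrow> (nat \<Rightarrow> real) set" where
  "sign_vectors p s = {c. (\<forall>i. c i \<in> {-1, 0, 1}) \<and> {i. c i \<noteq> 0} \<in> subsets_of_size p s}"

text \<open>A sign vector is determined by its support together with the set of its positive
  entries; \<open>g\<close> decodes such a pair.\<close>

lemma sign_vectors_finite_card:
  "finite (sign_vectors p s) \<and> card (sign_vectors p s) \<le> (p choose s) * 2 ^ s"
proof -
  define g :: "nat set \<times> nat set \<Rightarrow> nat \<Rightarrow> real"
    where "g = (\<lambda>(S, P) i. if i \<in> P then 1 else if i \<in> S then -1 else 0)"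
  let ?D = "SIGMA S:subsets_of_size p s. Pow S"
  have fin: "finite S" "card S = s" if "S \<in> subsets_of_size p s" for S
    using that finite_subset by (auto simp: subsets_of_size_def)
  have finD: "finite ?D" using fin finite_subsets_of_size by (intro finite_SigmaI) auto
  have sub: "sign_vectors p s \<subseteq> g ` ?D"
  proof
    fix c assume c: "c \<in> sign_vectors p s"
    have "c = g ({i. c i \<noteq> 0}, {i. c i = 1})"
    proof
      fix i
      have "c i \<in> {-1, 0, 1}" using c by (simp add: sign_vectors_def)
      then show "c i = g ({i. c i \<noteq> 0}, {i. c i = 1}) i" by (auto simp: g_def)
    qed
    moreover have "({i. c i \<noteq> 0}, {i. c i = 1}) \<in> ?D" using c by (auto simp: sign_vectors_def)
    ultimately show "c \<in> g ` ?D" by blast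
  qed
  have "card ?D = (\<Sum>S\<in>subsets_of_size p s. card (Pow S))"
    using fin finite_subsets_of_size by (intro card_SigmaI) auto
  also have "\<dots> = (p choose s) * 2 ^ s"
    using fin by (simp add: card_Pow card_subsets_of_size)
  finally have "card ?D = (p choose s) * 2 ^ s" .
  then show ?thesis
    using card_mono[OF finite_imageI[OF finD] sub] card_image_le[OF finD, of g]
      finite_subset[OF sub finite_imageI[OF finD]] by simp
qed

lemma sign_vectors_sums:
  assumes "c \<in> sign_vectors p s"
  shows "(\<Sum>j<p. \<bar>c j\<bar>) = real s" "(\<Sum>j<p. c j * c j) = real s"
proof -
  let ?S = "{i. c i \<noteq> 0}"
  have S: "?S \<subseteq> {..<p}" "card ?S = s" using assms by (auto simp: sign_vectors_def subsets_of_size_def)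
  have "\<bar>c j\<bar> = indicator ?S j" "c j * c j = indicator ?S j" for j
  proof -
    have "c j \<in> {-1, 0, 1}" using assms by (simp add: sign_vectors_def)
    then show "\<bar>c j\<bar> = indicator ?S j" "c j * c j = indicator ?S j" by auto
  qed
  then show "(\<Sum>j<p. \<bar>c j\<bar>) = real s" "(\<Sum>j<p. c j * c j) = real s"
    using sum_indicator_lessThan[OF S(1)] S(2) by simp_all
qed

lemma sign_vector_norm_le:
  assumes X: "near_orth n p (\<delta> / real s) X" and c: "c \<in> sign_vectors p s" and s: "0 < s"
  shows "inner_on n (mat_vec p X c) (mat_vec p X c) \<le> real n * real s * (1 + \<delta>)"
  using near_orth_gram[OF X, of c c] s
  by (simp add: sign_vectors_sums[OF c] algebra_simps)

definition scan_event :: "nat \<Rightarrow> nat \<Rightarrow> nat \<Rightarrow> real \<Rightarrow> (nat \<Rightarrow> nat \<Rightarrow> real) \<Rightarrow> (nat \<Rightarrow> real) \<Rightarrow> bool" where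
  "scan_event n p s t X y \<longleftrightarrow> (\<exists>c\<in>sign_vectors p s. t \<le> inner_on n (mat_vec p X c) y)"

lemma scan_type_I:
  assumes X: "near_orth n p (\<delta> / real s) X" and s: "0 < s" and n: "0 < n" and \<delta>: "0 \<le> \<delta>" and t: "0 \<le> t"
  shows "measure (noiseM n) {e \<in> space (noiseM n). scan_event n p s t X e}
     \<le> real ((p choose s) * 2 ^ s) * exp (- t\<^sup>2 / (2 * (real n * real s * (1 + \<delta>))))"
proof -
  interpret prob_space "noiseM n" by (rule prob_space_noiseM)
  let ?B = "\<lambda>c. {e \<in> space (noiseM n). t \<le> inner_on n (mat_vec p X c) e}"
  have "prob {e \<in> space (noiseM n). scan_event n p s t X e} = prob (\<Union>c\<in>sign_vectors p s. ?B c)"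
    by (rule arg_cong[of _ _ prob]) (auto simp: scan_event_def)
  also have "\<dots> \<le> (\<Sum>c\<in>sign_vectors p s. prob (?B c))"
    by (intro measure_UNION_le) (auto simp: sign_vectors_finite_card)
  also have "\<dots> \<le> (\<Sum>c\<in>sign_vectors p s. exp (- t\<^sup>2 / (2 * (real n * real s * (1 + \<delta>)))))"
    using X s n \<delta> t by (intro sum_mono noiseM_tail sign_vector_norm_le) (auto intro!: mult_pos_pos)
  also have "\<dots> = real (card (sign_vectors p s)) * exp (- t\<^sup>2 / (2 * (real n * real s * (1 + \<delta>))))"
    by simp
  also have "\<dots> \<le> real ((p choose s) * 2 ^ s) * exp (- t\<^sup>2 / (2 * (real n * real s * (1 + \<delta>))))"
    using sign_vectors_finite_card[of p s] by (intro mult_right_mono) (auto simp only: of_nat_le_iff exp_ge_zero)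
  finally show ?thesis .
qed

text \<open>It is enough that the scan contains the sign pattern of \<open>\<beta>\<close>. The Gram
  error is proportional to the l1 norm of \<open>\<beta>\<close>, as is the signal, so the mean
  loses only a factor \<open>1 - \<delta>\<close> however large the coefficients are, and one
  threshold serves all of \<open>Xi p s A\<close>.\<close>

lemma scan_type_II:
  assumes X: "near_orth n p (\<delta> / real s) X" and s: "0 < s" and n: "0 < n" and \<delta>: "0 \<le> \<delta>" "\<delta> \<le> 1" and A: "0 \<le> A"
    and t: "t \<le> real n * (1 - \<delta>) * real s * A" and \<beta>: "\<beta> \<in> Xi p s A"
  shows "measure (noiseM n) {e \<in> space (noiseM n). \<not> scan_event n p s t X (shift_on n (mat_vec p X \<beta>) e)}
     \<le> exp (- (real n * (1 - \<delta>) * real s * A - t)\<^sup>2 / (2 * (real n * real s * (1 + \<delta>))))"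
proof -
  interpret prob_space "noiseM n" by (rule prob_space_noiseM)
  let ?q = "real n * real s * (1 + \<delta>)" and ?m = "real n * (1 - \<delta>) * real s * A"
  define c where "c i = sgn (\<beta> i)" for i
  have supp: "{i. \<beta> i \<noteq> 0} \<subseteq> {..<p}" "card {i. \<beta> i \<noteq> 0} = s"
    using \<beta> by (auto simp: Xi_def not_less[symmetric])
  have c: "c \<in> sign_vectors p s"
  proof -
    have "{i. c i \<noteq> 0} = {i. \<beta> i \<noteq> 0}" "\<forall>i. c i \<in> {-1, 0, 1}" by (auto simp: c_def sgn_real_def)
    then show ?thesis using supp by (simp add: sign_vectors_def subsets_of_size_def)
  qed
  have b1: "(\<Sum>j<p. c j * \<beta> j) = (\<Sum>j<p. \<bar>\<beta> j\<bar>)" by (simp add: c_def abs_sgn mult.commute)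
  have "A * s = (\<Sum>j<p. A * indicator {i. \<beta> i \<noteq> 0} j)"
    using sum_indicator_lessThan[OF supp(1)] supp(2) by (simp add: sum_distrib_left[symmetric])
  also have "\<dots> \<le> (\<Sum>j<p. \<bar>\<beta> j\<bar>)"
    using \<beta> by (intro sum_mono) (auto simp: Xi_def indicator_def)
  finally have b2: "A * s \<le> (\<Sum>j<p. \<bar>\<beta> j\<bar>)" .
  have "?m \<le> real n * (1 - \<delta>) * (\<Sum>j<p. \<bar>\<beta> j\<bar>)"
    using mult_left_mono[OF b2, of "real n * (1 - \<delta>)"] \<delta> by (simp add: mult_ac)
  also have "\<dots> = real n * (\<Sum>j<p. c j * \<beta> j) - real n * (\<delta> / real s) * (\<Sum>j<p. \<bar>c j\<bar>) * (\<Sum>j<p. \<bar>\<beta> j\<bar>)"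
    unfolding b1 sign_vectors_sums[OF c] using s by (simp add: field_simps)
  also have "\<dots> \<le> inner_on n (mat_vec p X c) (mat_vec p X \<beta>)"
    using near_orth_gram[OF X, of c \<beta>] by linarith
  finally have mean: "?m \<le> inner_on n (mat_vec p X c) (mat_vec p X \<beta>)" .
  have m: "{e \<in> space (noiseM n). ?m - t \<le> inner_on n (\<lambda>i. (-1) * mat_vec p X c i) e} \<in> events"
    by measurable
  have "prob {e \<in> space (noiseM n). \<not> scan_event n p s t X (shift_on n (mat_vec p X \<beta>) e)}
      \<le> prob {e \<in> space (noiseM n). ?m - t \<le> inner_on n (\<lambda>i. (-1) * mat_vec p X c i) e}"
  proof (intro finite_measure_mono subsetI m)
    fix e assume "e \<in> {e \<in> space (noiseM n). \<not> scan_event n p s t X (shift_on n (mat_vec p X \<beta>) e)}"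
    then have "e \<in> space (noiseM n)" "inner_on n (mat_vec p X c) (shift_on n (mat_vec p X \<beta>) e) < t"
      using c by (auto simp: scan_event_def not_le)
    then have "?m - t \<le> (-1) * inner_on n (mat_vec p X c) e" "e \<in> space (noiseM n)"
      using mean by (simp_all add: inner_on_shift)
    then show "e \<in> {e \<in> space (noiseM n). ?m - t \<le> inner_on n (\<lambda>i. (-1) * mat_vec p X c i) e}"
      unfolding inner_on_scale(1) by blast
  qed
  also have "\<dots> \<le> exp (- (?m - t)\<^sup>2 / (2 * ?q))"
    using sign_vector_norm_le[OF X c s] s n \<delta> t
    by (intro noiseM_tail) (simp_all only: inner_on_scale, auto)
  finally show ?thesis .
qed

section \<open>Measurability of the scan test, of near-orthogonality and of the observation
  map\<close>

lemma measurable_entry [measurable]: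
  assumes "i < n" "j < p"
  shows "(\<lambda>X. X i j) \<in> borel_measurable (matM n p)"
proof -
  have "(\<lambda>X. X i) \<in> matM n p \<rightarrow>\<^sub>M vecM p"
    unfolding matM_def using assms by (intro measurable_component_singleton) auto
  moreover have "(\<lambda>x. x j) \<in> borel_measurable (vecM p)"
    unfolding vecM_def using assms by (intro measurable_component_singleton) auto
  ultimately show ?thesis by (rule measurable_compose)
qed

lemma measurable_vec_entry [measurable]:
  "i < n \<Longrightarrow> (\<lambda>y. y i) \<in> borel_measurable (vecM n)"
  unfolding vecM_def by (intro measurable_component_singleton) auto

lemma measurable_mat_vec [measurable]:
  "i < n \<Longrightarrow> (\<lambda>X. mat_vec p X c i) \<in> borel_measurable (matM n p)"
  unfolding mat_vec_def by (intro borel_measurable_sum borel_measurable_times) auto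

lemma measurable_inner_mat_vec:
  "(\<lambda>(y, X). inner_on n (mat_vec p X c) y) \<in> borel_measurable (obsM n p)"
  unfolding obsM_def inner_on_def split_beta'
  by (intro borel_measurable_sum borel_measurable_times
      measurable_compose[OF measurable_snd measurable_mat_vec] measurable_compose[OF measurable_fst measurable_vec_entry]) auto

lemma scan_test_in_tests:
  "(\<lambda>(y, X). if scan_event n p s t X y then 1 else 0) \<in> tests n p"
proof -
  have "{\<omega> \<in> space (obsM n p). scan_event n p s t (snd \<omega>) (fst \<omega>)}
     = (\<Union>c\<in>sign_vectors p s. {\<omega> \<in> space (obsM n p). t \<le> (\<lambda>(y, X). inner_on n (mat_vec p X c) y) \<omega>})"
    by (auto simp: scan_event_def)
  also have "\<dots> \<in> sets (obsM n p)"
    using measurable_inner_mat_vec sign_vectors_finite_card[of p s]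
    by (intro sets.finite_UN) (auto intro!: borel_measurable_le)
  finally have "(\<lambda>\<omega>. if scan_event n p s t (snd \<omega>) (fst \<omega>) then 1 else 0 :: real) \<in> borel_measurable (obsM n p)"
    by (intro measurable_If) auto
  then show ?thesis by (auto simp: tests_def split_beta')
qed

lemma near_orth_measurable:
  "{X \<in> space (matM n p). near_orth n p d X} \<in> sets (matM n p)"
proof -
  have [measurable]: "(\<lambda>X. \<Sum>i<n. X i j * X i k) \<in> borel_measurable (matM n p)" if "j \<in> {..<p}" "k \<in> {..<p}" for j k
    using that by (intro borel_measurable_sum borel_measurable_times) auto
  have "{X \<in> space (matM n p). near_orth n p d X}
     = {X \<in> space (matM n p). \<forall>j\<in>{..<p}. \<forall>k\<in>{..<p}. \<bar>(\<Sum>i<n. X i j * X i k) - (if j = k then real n else 0)\<bar> \<le> real n * d}"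
    by (auto simp: near_orth_def)
  also have "\<dots> \<in> sets (matM n p)" by measurable
  finally show ?thesis .
qed

lemma measurable_response:
  assumes "sets DX = sets (matM n p)"
  shows "(\<lambda>(X, e). (response n p X \<beta> e, X)) \<in> DX \<Otimes>\<^sub>M noiseM n \<rightarrow>\<^sub>M obsM n p"
proof -
  have "(\<lambda>\<omega>. response n p (fst \<omega>) \<beta> (snd \<omega>)) \<in> matM n p \<Otimes>\<^sub>M vecM n \<rightarrow>\<^sub>M vecM n"
    unfolding response_eq_shift shift_on_def vecM_def[of n]
    by (intro measurable_restrict borel_measurable_add
      measurable_compose[OF measurable_fst measurable_mat_vec] measurable_compose[OF measurable_snd])
      auto
  then have "(\<lambda>(X, e). (response n p X \<beta> e, X)) \<in> matM n p \<Otimes>\<^sub>M vecM n \<rightarrow>\<^sub>M obsM n p"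
    unfolding obsM_def split_beta' by (intro measurable_Pair) auto
  moreover have "sets (DX \<Otimes>\<^sub>M noiseM n) = sets (matM n p \<Otimes>\<^sub>M vecM n)"
    using assms sets_noiseM by (intro sets_pair_measure_cong) auto
  ultimately show ?thesis by (simp cong: measurable_cong_sets)
qed

section \<open>Concentration of sub-Gaussian designs\<close>

lemma nn_integral_exp_std_normal:
  "(\<integral>\<^sup>+g. ennreal (exp (t * g)) \<partial>std_normal) = ennreal (exp (t\<^sup>2 / 2))"
proof -
  interpret prob_space std_normal by (rule prob_space_std_normal)
  have "1 = (\<integral>\<^sup>+g. ennreal (exp (t * g - t\<^sup>2 / 2)) \<partial>std_normal)"
    using nn_integral_std_normal_shift[of "\<lambda>_. 1" t] emeasure_space_1 by simp
  then have "ennreal (exp (t\<^sup>2 / 2)) * 1 = (\<integral>\<^sup>+g. ennreal (exp (t\<^sup>2 / 2)) * ennreal (exp (t * g - t\<^sup>2 / 2)) \<partial>std_normal)"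
    by (subst nn_integral_cmult) auto
  then show ?thesis by (simp add: ennreal_mult[symmetric] mult_exp_exp)
qed

text \<open>The factor \<open>exp (g\<^sup>2 / 4)\<close> turns the standard normal density into
  \<open>sqrt 2\<close> times the normal density of variance 2.\<close>

lemma nn_integral_exp_sq_std_normal:
  "(\<integral>\<^sup>+g. ennreal (exp (g\<^sup>2 / 4)) \<partial>std_normal) \<le> 2"
proof -
  have d: "normal_density 0 1 g * exp (g\<^sup>2 / 4) = sqrt 2 * normal_density 0 (sqrt 2) g" for g
    by (simp add: normal_density_def mult_exp_exp real_sqrt_mult field_simps)
  have "(\<integral>\<^sup>+g. ennreal (exp (g\<^sup>2 / 4)) \<partial>std_normal)
      = (\<integral>\<^sup>+g. ennreal (normal_density 0 1 g * exp (g\<^sup>2 / 4)) \<partial>lborel)"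
    by (subst nn_integral_density) (auto simp: ennreal_mult)
  also have "\<dots> = (\<integral>\<^sup>+g. ennreal (sqrt 2) * ennreal (normal_density 0 (sqrt 2) g) \<partial>lborel)"
    unfolding d by (simp add: ennreal_mult)
  also have "\<dots> = ennreal (sqrt 2) * (\<integral>\<^sup>+g. ennreal (normal_density 0 (sqrt 2) g) \<partial>lborel)"
    by (subst nn_integral_cmult) auto
  also have "(\<integral>\<^sup>+g. ennreal (normal_density 0 (sqrt 2) g) \<partial>lborel) = 1"
    by (subst nn_integral_eq_integral) auto
  also have "ennreal (sqrt 2) * 1 \<le> ennreal 2"
    unfolding mult_1_right by (intro ennreal_leI real_le_lsqrt) auto
  finally show ?thesis by simp
qed

text \<open>Second-order Taylor expansion with Lagrange remainder. The linear term is kept exact so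
  that it vanishes in expectation for centred variables.\<close>

lemma exp_le_quadratic: "exp y \<le> 1 + y + y\<^sup>2 / 2 * exp \<bar>y :: real\<bar>"
proof -
  obtain t where t: "\<bar>t\<bar> \<le> \<bar>y\<bar>" "exp y = (\<Sum>m<2. y ^ m / fact m) + exp t / fact 2 * y ^ 2"
    using Maclaurin_exp_le[of y 2] by blast
  have "exp t * y\<^sup>2 \<le> exp \<bar>y\<bar> * y\<^sup>2" using t(1) by (intro mult_right_mono) auto
  then show ?thesis using t(2) by (simp add: numeral_2_eq_2 mult.commute)
qed

text \<open>\<open>\<tau>\<close> dominates \<open>\<sigma>2\<close> and is at least 1, so it can be
  divided by and its powers can be compared.\<close>

locale subG =
  fixes p :: nat and \<sigma>2 \<tau> :: real and \<mu> :: "(nat \<Rightarrow> real) measure"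
  assumes row: "subG_row p \<sigma>2 \<mu>" and \<tau>: "\<sigma>2 \<le> \<tau>" "1 \<le> \<tau>"
begin

sublocale prob_space \<mu> using row by (simp add: subG_row_def)

lemma sets_row [measurable_cong]: "sets \<mu> = sets (vecM p)"
  using row by (simp add: subG_row_def)

lemma coord_measurable [measurable]: "j < p \<Longrightarrow> (\<lambda>x. x j) \<in> borel_measurable \<mu>"
  unfolding measurable_cong_sets[OF sets_row refl] vecM_def by (intro measurable_component_singleton) auto

lemma coord_mgf:
  assumes j: "j < p"
  shows "(\<integral>\<^sup>+x. ennreal (exp (t * x j)) \<partial>\<mu>) \<le> ennreal (exp (\<tau> * t\<^sup>2 / 2))"
proof -
  define u :: "nat \<Rightarrow> real" where "u = indicator {j}"
  have u: "(\<Sum>i<p. u i * x i) = x j" for x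
  proof -
    have "(\<Sum>i<p. u i * x i) = (\<Sum>i<p. if i = j then x i else 0)"
      by (intro sum.cong) (auto simp: u_def)
    then show ?thesis using j by simp
  qed
  have "(\<Sum>i<p. (u i)\<^sup>2) = 1" using u[of u] by (simp add: power2_eq_square) (simp add: u_def)
  moreover have "\<forall>i\<ge>p. u i = 0" using j by (auto simp: u_def)
  ultimately have *: "integrable \<mu> (\<lambda>x. exp (t * x j))" "ln (\<integral>x. exp (t * x j) \<partial>\<mu>) \<le> \<sigma>2 * t\<^sup>2 / 2"
    using row unfolding subG_row_def by (auto simp: u dest!: spec[of _ u])
  have "(\<integral>x. exp (t * x j) \<partial>\<mu>) \<le> exp (\<sigma>2 * t\<^sup>2 / 2)"
  \<comment> \<open>A bound on a logarithm says something only about a positive integral; in the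
    other case the claim is trivial.\<close>
  proof (cases "(\<integral>x. exp (t * x j) \<partial>\<mu>) > 0")
    case True
    then show ?thesis using *(2) by (metis exp_le_cancel_iff exp_ln)
  next
    case False
    then show ?thesis using exp_gt_zero[of "\<sigma>2 * t\<^sup>2 / 2"] by linarith
  qed
  also have "\<dots> \<le> exp (\<tau> * t\<^sup>2 / 2)" using \<tau> by (auto intro!: mult_right_mono)
  finally show ?thesis using *(1) by (subst nn_integral_eq_integral) (auto intro!: ennreal_leI)
qed

text \<open>Writing \<open>exp (w\<^sup>2 / (4 \<tau>))\<close> as a Gaussian average of \<open>exp (t w)\<close> reduces the square
  to the sub-Gaussian moment generating function.\<close>

lemma coord_exp_sq:
  assumes j: "j < p"
  shows "(\<integral>\<^sup>+x. ennreal (exp ((x j)\<^sup>2 / (4 * \<tau>))) \<partial>\<mu>) \<le> 2"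
proof -
  interpret N: prob_space std_normal by (rule prob_space_std_normal)
  interpret P: pair_sigma_finite \<mu> std_normal ..
  \<comment> \<open>Chosen so that averaging \<open>exp (\<theta> * w * g)\<close> over a standard
    normal \<open>g\<close> gives \<open>exp (w\<^sup>2 / (4 * \<tau>))\<close>, while averaging
    over the row first leaves at most \<open>exp (g\<^sup>2 / 4)\<close>, which is still
    integrable.\<close>
  define \<theta> where "\<theta> = 1 / sqrt (2 * \<tau>)"
  have \<theta>: "\<theta>\<^sup>2 = 1 / (2 * \<tau>)" using \<tau> by (simp add: \<theta>_def power_divide)
  have "(\<integral>\<^sup>+x. ennreal (exp ((x j)\<^sup>2 / (4 * \<tau>))) \<partial>\<mu>)
      = (\<integral>\<^sup>+x. \<integral>\<^sup>+g. ennreal (exp ((\<theta> * x j) * g)) \<partial>std_normal \<partial>\<mu>)"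
    by (subst nn_integral_exp_std_normal) (simp add: power_mult_distrib \<theta>)
  also have "\<dots> = (\<integral>\<^sup>+g. \<integral>\<^sup>+x. ennreal (exp ((\<theta> * x j) * g)) \<partial>\<mu> \<partial>std_normal)"
    using j by (intro P.Fubini'[symmetric]) measurable
  also have "\<dots> \<le> (\<integral>\<^sup>+g. ennreal (exp (\<tau> * (\<theta> * g)\<^sup>2 / 2)) \<partial>std_normal)"
  proof (intro nn_integral_mono)
    fix g
    show "(\<integral>\<^sup>+x. ennreal (exp ((\<theta> * x j) * g)) \<partial>\<mu>) \<le> ennreal (exp (\<tau> * (\<theta> * g)\<^sup>2 / 2))"
      using coord_mgf[OF j, of "\<theta> * g"] by (simp add: mult_ac)
  qed
  also have "\<dots> = (\<integral>\<^sup>+g. ennreal (exp (g\<^sup>2 / 4)) \<partial>std_normal)"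
    using \<tau> by (simp add: power_mult_distrib \<theta>)
  also have "\<dots> \<le> 2" by (rule nn_integral_exp_sq_std_normal)
  finally show ?thesis .
qed

text \<open>Bernstein-type bound. The linear Taylor term vanishes by isotropy, and the remainder is
  at most \<open>(l / l0)\<^sup>2 * W\<close> with \<open>W\<close> of mean at most 6. The value
  \<open>l0 = 1 / (8 * \<tau>)\<close> is small enough for the exponential squares of the two
  coordinates to control \<open>exp (2 * l0 * \<bar>Z\<bar>)\<close>; rounding 6 up to 8 gives
  \<open>8 * 64 = 512\<close>.\<close>

lemma product_mgf:
  assumes j: "j < p" and k: "k < p" and l: "\<bar>l\<bar> \<le> 1 / (8 * \<tau>)"
  shows "(\<integral>\<^sup>+x. ennreal (exp (l * (x j * x k - (if j = k then 1 else 0)))) \<partial>\<mu>) \<le> ennreal (exp (512 * \<tau>\<^sup>2 * l\<^sup>2))"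
proof -
  define c :: real where "c = (if j = k then 1 else 0)"
  define Z where "Z x = x j * x k - c" for x
  define W where "W x = 3 * ((exp ((x j)\<^sup>2 / (4 * \<tau>)) + exp ((x k)\<^sup>2 / (4 * \<tau>))) / 2)" for x
  define l0 where "l0 = 1 / (8 * \<tau>)"
  have l0: "0 < l0" "\<bar>l\<bar> \<le> l0" using l \<tau> by (auto simp: l0_def)
  have Z: "integrable \<mu> Z" "(\<integral>x. Z x \<partial>\<mu>) = 0"
  proof -
    have a: "integrable \<mu> (\<lambda>x. x j * x k)" "(\<integral>x. x j * x k \<partial>\<mu>) = c"
      using row j k by (auto simp: subG_row_def c_def)
    then show "integrable \<mu> Z" unfolding Z_def by simp
    show "(\<integral>x. Z x \<partial>\<mu>) = 0" unfolding Z_def using a by (simp add: prob_space)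
  qed
  have Wj: "integrable \<mu> (\<lambda>x. exp ((x i)\<^sup>2 / (4 * \<tau>)))" "(\<integral>x. exp ((x i)\<^sup>2 / (4 * \<tau>)) \<partial>\<mu>) \<le> 2" if "i < p" for i
  proof -
    show 1: "integrable \<mu> (\<lambda>x. exp ((x i)\<^sup>2 / (4 * \<tau>)))"
      using that coord_exp_sq[OF that] by (intro integrableI_nonneg) (auto simp: order_le_less_trans)
    have "ennreal (\<integral>x. exp ((x i)\<^sup>2 / (4 * \<tau>)) \<partial>\<mu>) \<le> ennreal 2"
      using coord_exp_sq[OF that] 1 by (subst nn_integral_eq_integral[symmetric]) auto
    then show "(\<integral>x. exp ((x i)\<^sup>2 / (4 * \<tau>)) \<partial>\<mu>) \<le> 2" by (subst (asm) ennreal_le_iff) auto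
  qed
  have W: "integrable \<mu> W" "(\<integral>x. W x \<partial>\<mu>) \<le> 6"
    unfolding W_def using Wj[OF j] Wj[OF k] by auto
  \<comment> \<open>AM-GM is used twice, for \<open>x j * x k\<close> and for the product of
    exponentials. The centring constant \<open>c\<close> costs at most \<open>exp 1 \<le> 3\<close>,
    the factor 3 in \<open>W\<close>.\<close>
  have WZ: "exp (2 * l0 * \<bar>Z x\<bar>) \<le> W x" for x
  proof -
    let ?A = "(x j)\<^sup>2 / (4 * \<tau>)" and ?B = "(x k)\<^sup>2 / (4 * \<tau>)"
    have "0 \<le> (\<bar>x j\<bar> - \<bar>x k\<bar>)\<^sup>2" by simp
    then have "\<bar>x j * x k\<bar> \<le> ((x j)\<^sup>2 + (x k)\<^sup>2) / 2" by (simp add: power2_diff abs_mult)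
    moreover have "\<bar>c\<bar> \<le> 1" by (simp add: c_def)
    ultimately have "\<bar>Z x\<bar> \<le> 1 + ((x j)\<^sup>2 + (x k)\<^sup>2) / 2" unfolding Z_def by linarith
    then have "2 * l0 * \<bar>Z x\<bar> \<le> 2 * l0 * (1 + ((x j)\<^sup>2 + (x k)\<^sup>2) / 2)" using l0 by (intro mult_left_mono) auto
    also have "\<dots> = 2 * l0 + (?A / 2 + ?B / 2)" using \<tau> by (simp add: l0_def field_simps)
    also have "\<dots> \<le> 1 + (?A / 2 + ?B / 2)" using \<tau> by (simp add: l0_def field_simps)
    finally have "exp (2 * l0 * \<bar>Z x\<bar>) \<le> exp 1 * (exp (?A / 2) * exp (?B / 2))"
      by (simp add: mult_exp_exp)
    also have "\<dots> \<le> 3 * ((exp ?A + exp ?B) / 2)"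
    proof (intro mult_mono)
      have "0 \<le> (exp (?A / 2) - exp (?B / 2))\<^sup>2" by simp
      also have "\<dots> = exp ?A + exp ?B - 2 * (exp (?A / 2) * exp (?B / 2))"
        by (simp add: power2_diff exp_double[symmetric])
      finally show "exp (?A / 2) * exp (?B / 2) \<le> (exp ?A + exp ?B) / 2" by simp
    qed (use exp_le in auto)
    finally show ?thesis by (simp add: W_def)
  qed
  have R: "exp (l * Z x) \<le> 1 + l * Z x + (l / l0)\<^sup>2 * W x" for x
  proof -
    \<comment> \<open>One factor \<open>exp (l0 * \<bar>Z x\<bar>)\<close> absorbs the square and
      another one the exponential; hence the 2 in \<open>WZ\<close>.\<close>
    have "(l * Z x)\<^sup>2 / 2 * exp \<bar>l * Z x\<bar> = (l / l0)\<^sup>2 * ((l0 * \<bar>Z x\<bar>)\<^sup>2 / 2 * exp \<bar>l * Z x\<bar>)"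
      using l0 by (simp add: power_mult_distrib power_divide)
    also have "\<dots> \<le> (l / l0)\<^sup>2 * (exp (l0 * \<bar>Z x\<bar>) * exp (l0 * \<bar>Z x\<bar>))"
    proof (intro mult_left_mono mult_mono)
      show "(l0 * \<bar>Z x\<bar>)\<^sup>2 / 2 \<le> exp (l0 * \<bar>Z x\<bar>)"
        using power_div_fact_le_exp[of "l0 * \<bar>Z x\<bar>" 2] l0 by simp
      show "exp \<bar>l * Z x\<bar> \<le> exp (l0 * \<bar>Z x\<bar>)" using l0 by (auto simp: abs_mult intro!: mult_right_mono)
    qed auto
    also have "\<dots> \<le> (l / l0)\<^sup>2 * W x"
      using WZ[of x] by (intro mult_left_mono) (auto simp: mult_exp_exp mult.assoc)
    finally show ?thesis using exp_le_quadratic[of "l * Z x"] by linarith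
  qed
  have "(\<integral>\<^sup>+x. ennreal (exp (l * Z x)) \<partial>\<mu>) \<le> (\<integral>\<^sup>+x. ennreal (1 + l * Z x + (l / l0)\<^sup>2 * W x) \<partial>\<mu>)"
    by (intro nn_integral_mono ennreal_leI R)
  also have "\<dots> = ennreal (\<integral>x. 1 + l * Z x + (l / l0)\<^sup>2 * W x \<partial>\<mu>)"
    using Z W by (intro nn_integral_eq_integral) (auto intro: order_trans[OF exp_ge_zero R])
  also have "(\<integral>x. 1 + l * Z x + (l / l0)\<^sup>2 * W x \<partial>\<mu>) = 1 + (l / l0)\<^sup>2 * (\<integral>x. W x \<partial>\<mu>)"
    using Z W by (simp add: prob_space)
  also have "ennreal \<dots> \<le> ennreal (exp (512 * \<tau>\<^sup>2 * l\<^sup>2))"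
  proof (intro ennreal_leI)
    have "(l / l0)\<^sup>2 * (\<integral>x. W x \<partial>\<mu>) \<le> (l / l0)\<^sup>2 * 8" using W by (intro mult_left_mono) auto
    also have "\<dots> = 512 * \<tau>\<^sup>2 * l\<^sup>2" by (simp add: l0_def power_mult_distrib)
    finally show "1 + (l / l0)\<^sup>2 * (\<integral>x. W x \<partial>\<mu>) \<le> exp (512 * \<tau>\<^sup>2 * l\<^sup>2)"
      using exp_ge_add_one_self[of "512 * \<tau>\<^sup>2 * l\<^sup>2"] by linarith
  qed
  finally show ?thesis by (simp add: Z_def c_def)
qed

text \<open>Chernoff bound for a sum over independent rows; \<open>\<kappa>\<close> selects the
  upper or the lower tail.\<close>

lemma gram_entry_tail:
  assumes j: "j < p" and k: "k < p" and d: "0 \<le> d" "d \<le> 1" and \<kappa>: "\<kappa> = 1 \<or> \<kappa> = - (1::real)"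
  shows "emeasure (PiM {..<n} (\<lambda>_. \<mu>)) {X \<in> space (PiM {..<n} (\<lambda>_. \<mu>)).
      real n * d < \<kappa> * ((\<Sum>i<n. X i j * X i k) - (if j = k then real n else 0))}
    \<le> ennreal (exp (- (real n * d\<^sup>2 / (2048 * \<tau>\<^sup>2))))"
    (is "emeasure ?M ?A \<le> _")
proof -
  interpret P: product_sigma_finite "\<lambda>_::nat. \<mu>" ..
  define Z where "Z x = x j * x k - (if j = k then 1 else 0)" for x :: "nat \<Rightarrow> real"
  \<comment> \<open>The minimiser of \<open>- (l * d) + 512 * \<tau>\<^sup>2 * l\<^sup>2\<close>;
    \<open>d \<le> 1\<close> keeps it within the range of \<open>product_mgf\<close>.\<close>
  define l where "l = d / (1024 * \<tau>\<^sup>2)"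
  have t2: "\<tau> \<le> \<tau>\<^sup>2" using \<tau> by (simp add: power2_eq_square)
  have l: "0 \<le> l" "\<bar>\<kappa> * l\<bar> \<le> 1 / (8 * \<tau>)"
  proof -
    show "0 \<le> l" using d \<tau> by (simp add: l_def)
    then have "\<bar>\<kappa> * l\<bar> = l" using \<kappa> by (auto simp: abs_mult)
    also have "l \<le> 1 / (1024 * \<tau>\<^sup>2)" using d unfolding l_def by (intro divide_right_mono) auto
    also have "\<dots> \<le> 1 / (8 * \<tau>)" using t2 \<tau> by (intro divide_left_mono mult_mono mult_pos_pos) auto
    finally show "\<bar>\<kappa> * l\<bar> \<le> 1 / (8 * \<tau>)" .
  qed
  have [measurable]: "(\<lambda>x. x j) \<in> borel_measurable \<mu>" "(\<lambda>x. x k) \<in> borel_measurable \<mu>" using j k by auto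
  have [measurable]: "(\<lambda>X. X i) \<in> ?M \<rightarrow>\<^sub>M \<mu>" if "i \<in> {..<n}" for i
    using that by (intro measurable_component_singleton) auto
  have mA: "?A \<in> sets ?M"
  proof -
    have "(\<lambda>X. X i j) \<in> borel_measurable ?M" "(\<lambda>X. X i k) \<in> borel_measurable ?M" if "i \<in> {..<n}" for i
      using that by measurable
    note [measurable] = this
    show ?thesis by measurable
  qed
  have Zs: "(\<Sum>i<n. Z (X i)) = (\<Sum>i<n. X i j * X i k) - (if j = k then real n else 0)" for X
    by (simp add: Z_def sum_subtractf)
  let ?f = "\<lambda>x. ennreal (exp (- (l * d))) * ennreal (exp (\<kappa> * l * Z x))"
  have "emeasure ?M ?A = (\<integral>\<^sup>+X. indicator ?A X \<partial>?M)" using mA by simp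
  also have "\<dots> \<le> (\<integral>\<^sup>+X. (\<Prod>i<n. ?f (X i)) \<partial>?M)"
  proof (intro nn_integral_mono)
    fix X
    have "1 \<le> exp (\<Sum>i<n. - (l * d) + \<kappa> * l * Z (X i))" if "X \<in> ?A"
    proof -
      have "l * (real n * d) \<le> l * (\<kappa> * (\<Sum>i<n. Z (X i)))"
        using that l by (intro mult_left_mono) (auto simp: Zs)
      then show ?thesis by (simp add: sum.distrib sum_distrib_left[symmetric] sum_subtractf algebra_simps)
    qed
    moreover have "(\<Prod>i<n. ?f (X i)) = ennreal (exp (\<Sum>i<n. - (l * d) + \<kappa> * l * Z (X i)))"
      by (simp add: ennreal_mult[symmetric] mult_exp_exp prod_ennreal exp_sum)
    ultimately show "indicator ?A X \<le> (\<Prod>i<n. ?f (X i))"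
      by (auto simp: indicator_def simp flip: ennreal_1 intro!: ennreal_leI)
  qed
  also have "\<dots> = (\<Prod>i<n. \<integral>\<^sup>+x. ?f x \<partial>\<mu>)"
    by (intro P.product_nn_integral_prod) (auto simp: Z_def)
  also have "\<dots> \<le> (\<Prod>i<n. ennreal (exp (- (l * d)) * exp (512 * \<tau>\<^sup>2 * l\<^sup>2)))"
    unfolding prod_constant
  proof (intro power_mono)
    have "(\<integral>\<^sup>+x. ?f x \<partial>\<mu>) = ennreal (exp (- (l * d))) * (\<integral>\<^sup>+x. ennreal (exp (\<kappa> * l * Z x)) \<partial>\<mu>)"
      by (intro nn_integral_cmult) (auto simp: Z_def)
    also have "\<dots> \<le> ennreal (exp (- (l * d))) * ennreal (exp (512 * \<tau>\<^sup>2 * (\<kappa> * l)\<^sup>2))"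
      unfolding Z_def by (intro mult_left_mono product_mgf j k l) auto
    also have "(\<kappa> * l)\<^sup>2 = l\<^sup>2" using \<kappa> by auto
    finally show "(\<integral>\<^sup>+x. ?f x \<partial>\<mu>) \<le> ennreal (exp (- (l * d)) * exp (512 * \<tau>\<^sup>2 * l\<^sup>2))"
      by (simp add: ennreal_mult)
  qed auto
  also have "\<dots> = ennreal (exp (real n * (- (l * d) + 512 * \<tau>\<^sup>2 * l\<^sup>2)))"
    by (simp add: ennreal_power exp_of_nat_mult mult_exp_exp)
  also have "- (l * d) + 512 * \<tau>\<^sup>2 * l\<^sup>2 = - (d\<^sup>2 / (2048 * \<tau>\<^sup>2))"
    using \<tau> by (simp add: l_def power2_eq_square field_simps)
  finally show ?thesis by simp
qed

lemma near_orth_tail: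
  assumes d: "0 \<le> d" "d \<le> 1"
  shows "emeasure (PiM {..<n} (\<lambda>_. \<mu>)) {X \<in> space (PiM {..<n} (\<lambda>_. \<mu>)). \<not> near_orth n p d X}
    \<le> ennreal (2 * (real p)\<^sup>2 * exp (- (real n * d\<^sup>2 / (2048 * \<tau>\<^sup>2))))"
    (is "emeasure ?M ?B \<le> _")
proof -
  let ?A = "\<lambda>(j, k, \<kappa>). {X \<in> space ?M. real n * d < \<kappa> * ((\<Sum>i<n. X i j * X i k) - (if j = k then real n else 0))}"
  let ?I = "{..<p} \<times> {..<p} \<times> {1, -1 :: real}"
  have "(\<lambda>X. X i) \<in> ?M \<rightarrow>\<^sub>M \<mu>" if "i \<in> {..<n}" for i
    using that by (intro measurable_component_singleton) auto
  then have [measurable]: "(\<lambda>X. X i j) \<in> borel_measurable ?M" if "i \<in> {..<n}" "j < p" for i j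
    using that by (auto intro: measurable_compose[OF _ coord_measurable])
  have "?B \<subseteq> (\<Union>x\<in>?I. ?A x)"
  proof
    fix X assume "X \<in> ?B"
    then obtain j k where "j < p" "k < p" "X \<in> space ?M"
      "real n * d < \<bar>(\<Sum>i<n. X i j * X i k) - (if j = k then real n else 0)\<bar>"
      by (auto simp: near_orth_def not_le)
    then have "X \<in> ?A (j, k, 1) \<or> X \<in> ?A (j, k, -1)" "(j, k, 1) \<in> ?I" "(j, k, -1) \<in> ?I"
      by (auto simp: abs_if split: if_splits)
    then show "X \<in> (\<Union>x\<in>?I. ?A x)" by blast
  qed
  then have "emeasure ?M ?B \<le> emeasure ?M (\<Union>x\<in>?I. ?A x)"
    by (intro emeasure_mono sets.finite_UN) auto
  also have "\<dots> \<le> (\<Sum>x\<in>?I. emeasure ?M (?A x))"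
    by (intro emeasure_subadditive_finite) auto
  also have "\<dots> \<le> (\<Sum>x\<in>?I. ennreal (exp (- (real n * d\<^sup>2 / (2048 * \<tau>\<^sup>2)))))"
  proof (intro sum_mono)
    fix x assume "x \<in> ?I"
    then obtain j k \<kappa> where x: "x = (j, k, \<kappa>)" "j < p" "k < p" "\<kappa> = 1 \<or> \<kappa> = - (1::real)" by auto
    show "emeasure ?M (?A x) \<le> ennreal (exp (- (real n * d\<^sup>2 / (2048 * \<tau>\<^sup>2))))"
      using gram_entry_tail[OF x(2,3) d x(4)] by (simp add: x(1))
  qed
  also have "\<dots> = ennreal (2 * (real p)\<^sup>2 * exp (- (real n * d\<^sup>2 / (2048 * \<tau>\<^sup>2))))"
  proof -
    have "card ?I = 2 * p\<^sup>2" by (simp add: card_cartesian_product power2_eq_square)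
    then show ?thesis by (simp add: ennreal_of_nat_eq_real_of_nat ennreal_mult'[symmetric])
  qed
  finally show ?thesis .
qed

end

section \<open>Random designs\<close>

lemma (in prob_space) integral_unit_interval:
  assumes [measurable]: "f \<in> borel_measurable M" and "\<And>x. x \<in> space M \<Longrightarrow> 0 \<le> f x \<and> f x \<le> (1::real)"
  shows "integrable M f" "0 \<le> integral\<^sup>L M f" "integral\<^sup>L M f \<le> 1"
proof -
  show i: "integrable M f" using assms by (intro integrable_const_bound[where B=1]) auto
  show "0 \<le> integral\<^sup>L M f" using assms by (intro integral_nonneg_AE) auto
  have "integral\<^sup>L M f \<le> integral\<^sup>L M (\<lambda>_. 1)" using assms i by (intro integral_mono) auto
  then show "integral\<^sup>L M f \<le> 1" by (simp add: prob_space)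
qed

locale random_design =
  fixes n p :: nat and DX :: "(nat \<Rightarrow> nat \<Rightarrow> real) measure"
  assumes prob: "prob_space DX" and sets_DX [measurable_cong]: "sets DX = sets (matM n p)"
begin

sublocale D: prob_space DX by (rule prob)
sublocale N: prob_space "noiseM n" by (rule prob_space_noiseM)
sublocale DN: pair_prob_space DX "noiseM n" ..

lemma space_DX: "space DX = space (matM n p)"
  by (rule sets_eq_imp_space_eq[OF sets_DX])

lemma response_in_space:
  "X \<in> space (matM n p) \<Longrightarrow> (response n p X \<beta> e, X) \<in> space (obsM n p)"
  by (auto simp: obsM_def space_pair_measure vecM_def space_PiM response_def)

lemma tests_compl: "T \<in> tests n p \<Longrightarrow> (\<lambda>\<omega>. 1 - T \<omega>) \<in> tests n p"
  by (auto simp: tests_def)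

lemma test_compose:
  assumes "T \<in> tests n p"
  shows "(\<lambda>\<omega>. T (response n p (fst \<omega>) \<beta> (snd \<omega>), fst \<omega>)) \<in> borel_measurable (DX \<Otimes>\<^sub>M noiseM n)"
    and "\<omega> \<in> space (DX \<Otimes>\<^sub>M noiseM n) \<Longrightarrow>
      0 \<le> T (response n p (fst \<omega>) \<beta> (snd \<omega>), fst \<omega>) \<and> T (response n p (fst \<omega>) \<beta> (snd \<omega>), fst \<omega>) \<le> 1"
proof -
  show "(\<lambda>\<omega>. T (response n p (fst \<omega>) \<beta> (snd \<omega>), fst \<omega>)) \<in> borel_measurable (DX \<Otimes>\<^sub>M noiseM n)"
    using measurable_compose[OF measurable_response[OF sets_DX, where \<beta>=\<beta>], of T borel] assms
    by (simp add: tests_def split_beta')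
  assume "\<omega> \<in> space (DX \<Otimes>\<^sub>M noiseM n)"
  then have "(response n p (fst \<omega>) \<beta> (snd \<omega>), fst \<omega>) \<in> space (obsM n p)"
    by (intro response_in_space) (auto simp: space_pair_measure space_DX)
  then show "0 \<le> T (response n p (fst \<omega>) \<beta> (snd \<omega>), fst \<omega>) \<and> T (response n p (fst \<omega>) \<beta> (snd \<omega>), fst \<omega>) \<le> 1"
    using assms by (simp add: tests_def)
qed

lemma Exp_bounds:
  assumes "T \<in> tests n p"
  shows "0 \<le> Exp n p DX \<beta> T" "Exp n p DX \<beta> T \<le> 1"
  unfolding Exp_def using test_compose[OF assms] by (auto intro!: DN.integral_unit_interval)

text \<open>Fubini with the design as outer variable, so that the bounds for a fixed design apply to
  the inner integral.\<close>

lemma Exp_eq_nn_integral: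
  assumes "T \<in> tests n p"
  shows "ennreal (Exp n p DX \<beta> T)
    = (\<integral>\<^sup>+X. \<integral>\<^sup>+e. ennreal (T (shift_on n (mat_vec p X \<beta>) e, X)) \<partial>noiseM n \<partial>DX)"
proof -
  have "ennreal (Exp n p DX \<beta> T)
    = (\<integral>\<^sup>+\<omega>. ennreal (T (response n p (fst \<omega>) \<beta> (snd \<omega>), fst \<omega>)) \<partial>(DX \<Otimes>\<^sub>M noiseM n))"
    unfolding Exp_def using test_compose[OF assms]
    by (intro nn_integral_eq_integral[symmetric] DN.integral_unit_interval) auto
  also have "\<dots> = (\<integral>\<^sup>+X. \<integral>\<^sup>+e. ennreal (T (response n p X \<beta> e, X)) \<partial>noiseM n \<partial>DX)"
    using test_compose[OF assms, where \<beta>=\<beta>]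
    by (subst N.nn_integral_fst[symmetric]) auto
  finally show ?thesis by (simp add: response_eq_shift)
qed

lemma slice_measurable:
  assumes "T \<in> tests n p" "X \<in> space DX"
  shows "(\<lambda>y. T (y, X)) \<in> borel_measurable (vecM n)"
proof -
  have "(\<lambda>y. (y, X)) \<in> vecM n \<rightarrow>\<^sub>M obsM n p"
    using assms unfolding obsM_def space_DX by measurable
  then show ?thesis using assms by (auto simp: tests_def intro: measurable_compose)
qed

lemma Exp_bdd_above: "T \<in> tests n p \<Longrightarrow> bdd_above ((\<lambda>\<beta>. Exp n p DX \<beta> (\<lambda>\<omega>. 1 - T \<omega>)) ` Xi p s A)"
  using Exp_bounds tests_compl by (intro bdd_aboveI[where M=1]) auto

lemma Xi_indicator:
  assumes "S \<in> subsets_of_size p s" "0 < A"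
  shows "(\<lambda>i. A * indicator S i) \<in> Xi p s A"
proof -
  have "{i. A * indicator S i \<noteq> 0} = S" using assms by (auto simp: indicator_def)
  then show ?thesis using assms by (auto simp: Xi_def subsets_of_size_def indicator_def)
qed

lemma Xi_nonempty: "s \<le> p \<Longrightarrow> 0 < A \<Longrightarrow> Xi p s A \<noteq> {}"
  using Xi_indicator[of "{..<s}" s A] by (auto simp: subsets_of_size_def)

text \<open>Serves to bound the infimum over tests from below. On \<open>real\<close>,
  \<open>SUP\<close> and \<open>INF\<close> are meaningful for bounded nonempty sets;
  \<open>s \<le> p\<close> and \<open>0 < A\<close> make \<open>Xi p s A\<close> nonempty.\<close>

lemma risk_test_nonneg:
  assumes "T \<in> tests n p" "s \<le> p" "0 < A"
  shows "0 \<le> risk_test n p DX s A T"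
proof -
  obtain \<beta> where \<beta>: "\<beta> \<in> Xi p s A" using Xi_nonempty assms by blast
  have "0 \<le> Exp n p DX \<beta> (\<lambda>\<omega>. 1 - T \<omega>)" by (rule Exp_bounds[OF tests_compl[OF assms(1)]])
  also have "\<dots> \<le> (SUP \<beta>\<in>Xi p s A. Exp n p DX \<beta> (\<lambda>\<omega>. 1 - T \<omega>))"
    by (intro cSUP_upper \<beta> Exp_bdd_above assms)
  finally show ?thesis using Exp_bounds[OF assms(1)] by (simp add: risk_test_def)
qed

text \<open>On bad designs the conditional error is bounded by 1, so they add just their
  probability.\<close>

lemma near_orth_prob:
  assumes bad: "measure DX {X \<in> space DX. \<not> near_orth n p d X} \<le> b"
    and F[measurable]: "F \<in> borel_measurable DX" and F1: "\<And>X. X \<in> space DX \<Longrightarrow> F X \<le> (1::ennreal)"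
    and good: "\<And>X. X \<in> space DX \<Longrightarrow> near_orth n p d X \<Longrightarrow> F X \<le> ennreal \<epsilon>"
    and \<epsilon>: "0 \<le> \<epsilon>"
  shows "(\<integral>\<^sup>+X. F X \<partial>DX) \<le> ennreal (\<epsilon> + b)"
proof -
  let ?B = "{X \<in> space DX. \<not> near_orth n p d X}"
  have "{X \<in> space (matM n p). \<not> near_orth n p d X} = space (matM n p) - {X \<in> space (matM n p). near_orth n p d X}"
    by auto
  then have B[measurable]: "?B \<in> sets DX"
    using near_orth_measurable[of n p d] by (simp add: space_DX sets_DX)
  have "(\<integral>\<^sup>+X. F X \<partial>DX) \<le> (\<integral>\<^sup>+X. ennreal \<epsilon> + indicator ?B X \<partial>DX)"
  proof (intro nn_integral_mono)
    fix X assume "X \<in> space DX"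
    then show "F X \<le> ennreal \<epsilon> + indicator ?B X"
      using add_increasing[OF zero_le F1[of X], of "ennreal \<epsilon>"] good[of X]
      by (cases "near_orth n p d X") auto
  qed
  also have "\<dots> = ennreal \<epsilon> + emeasure DX ?B"
    by (subst nn_integral_add) (auto simp: D.emeasure_space_1)
  also have "\<dots> \<le> ennreal (\<epsilon> + b)"
    using bad \<epsilon> order_trans[OF measure_nonneg bad]
    by (simp add: D.emeasure_eq_measure ennreal_plus[symmetric] ennreal_leI del: ennreal_plus)
  finally show ?thesis .
qed

lemma minimax_risk_upper:
  assumes bad: "measure DX {X \<in> space DX. \<not> near_orth n p (\<delta> / real s) X} \<le> b"
    and s: "0 < s" "s \<le> p" and n: "0 < n" and \<delta>: "0 \<le> \<delta>" "\<delta> \<le> 1" and A: "0 < A"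
    and t: "0 \<le> t" "t \<le> real n * (1 - \<delta>) * real s * A"
  shows "minimax_risk n p DX s A
    \<le> (real ((p choose s) * 2 ^ s) * exp (- t\<^sup>2 / (2 * (real n * real s * (1 + \<delta>)))) + b)
      + (exp (- (real n * (1 - \<delta>) * real s * A - t)\<^sup>2 / (2 * (real n * real s * (1 + \<delta>)))) + b)"
    (is "_ \<le> (?e1 + b) + (?e2 + b)")
proof -
  define T :: "(nat \<Rightarrow> real) \<times> (nat \<Rightarrow> nat \<Rightarrow> real) \<Rightarrow> real"
    where "T = (\<lambda>(y, X). if scan_event n p s t X y then 1 else 0)"
  have T: "T \<in> tests n p" unfolding T_def by (rule scan_test_in_tests)
  have b0: "0 \<le> b" using bad measure_nonneg order_trans by blast
  \<comment> \<open>Shared by the two error types: \<open>T'\<close> is the scan test or its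
    complement, and \<open>Q\<close> is the event whose indicator it is. Measurability of that event
    is read off from \<open>T'\<close>.\<close>
  have core: "Exp n p DX \<beta> T' \<le> \<epsilon> + b"
    if T': "T' \<in> tests n p" and \<epsilon>: "0 \<le> \<epsilon>"
      and ind: "\<And>y X. T' (y, X) = (if Q X y then 1 else 0)"
      and le: "\<And>X. X \<in> space DX \<Longrightarrow> near_orth n p (\<delta> / real s) X \<Longrightarrow>
           measure (noiseM n) {e \<in> space (noiseM n). Q X (shift_on n (mat_vec p X \<beta>) e)} \<le> \<epsilon>"
    for \<beta> T' \<epsilon> Q
  proof -
    let ?F = "\<lambda>X. \<integral>\<^sup>+e. ennreal (T' (shift_on n (mat_vec p X \<beta>) e, X)) \<partial>noiseM n"
    have m: "?F \<in> borel_measurable DX"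
      using test_compose(1)[OF T', of \<beta>] unfolding response_eq_shift
      by (intro N.borel_measurable_nn_integral) (simp add: split_beta')
    have F: "?F X = emeasure (noiseM n) {e \<in> space (noiseM n). Q X (shift_on n (mat_vec p X \<beta>) e)}"
      if "X \<in> space DX" for X
    proof -
      have sm: "(\<lambda>e. T' (shift_on n (mat_vec p X \<beta>) e, X)) \<in> borel_measurable (noiseM n)"
        using measurable_compose[OF measurable_shift_on slice_measurable[OF T' that]]
        by (simp cong: measurable_cong_sets add: sets_noiseM)
      have "{e \<in> space (noiseM n). Q X (shift_on n (mat_vec p X \<beta>) e)}
         = {e \<in> space (noiseM n). T' (shift_on n (mat_vec p X \<beta>) e, X) = 1}" by (auto simp: ind)
      also have "\<dots> \<in> sets (noiseM n)" using sm by measurable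
      finally have "emeasure (noiseM n) {e \<in> space (noiseM n). Q X (shift_on n (mat_vec p X \<beta>) e)}
         = (\<integral>\<^sup>+e. indicator {e \<in> space (noiseM n). Q X (shift_on n (mat_vec p X \<beta>) e)} e \<partial>noiseM n)" by simp
      also have "\<dots> = ?F X" by (intro nn_integral_cong) (auto simp: ind indicator_def)
      finally show ?thesis by simp
    qed
    have "ennreal (Exp n p DX \<beta> T') = (\<integral>\<^sup>+X. ?F X \<partial>DX)" by (rule Exp_eq_nn_integral[OF T'])
    also have "\<dots> \<le> ennreal (\<epsilon> + b)"
      using le by (intro near_orth_prob[OF bad m]) (auto simp: F \<epsilon> N.emeasure_eq_measure N.prob_le_1 intro!: ennreal_leI)
    finally show ?thesis using \<epsilon> b0 by (subst (asm) ennreal_le_iff) auto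
  qed
  have 1: "Exp n p DX (\<lambda>_. 0) T \<le> ?e1 + b"
  proof (rule core[of T ?e1 "scan_event n p s t" "\<lambda>_. 0", OF T])
    fix X assume "X \<in> space DX" "near_orth n p (\<delta> / real s) X"
    have "inner_on n w (shift_on n (mat_vec p X (\<lambda>_. 0)) e) = inner_on n w e" for w e
      by (simp add: inner_on_shift) (simp add: inner_on_def mat_vec_def)
    then have "scan_event n p s t X (shift_on n (mat_vec p X (\<lambda>_. 0)) e) = scan_event n p s t X e" for e
      by (simp add: scan_event_def)
    then show "measure (noiseM n) {e \<in> space (noiseM n). scan_event n p s t X (shift_on n (mat_vec p X (\<lambda>_. 0)) e)} \<le> ?e1"
      using scan_type_I[OF \<open>near_orth n p (\<delta> / real s) X\<close> s(1) n \<delta>(1) t(1)] by simp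
  qed (auto simp: T_def)
  have 2: "Exp n p DX \<beta> (\<lambda>\<omega>. 1 - T \<omega>) \<le> ?e2 + b" if "\<beta> \<in> Xi p s A" for \<beta>
    by (rule core[of "\<lambda>\<omega>. 1 - T \<omega>" ?e2 "\<lambda>X y. \<not> scan_event n p s t X y" \<beta>, OF tests_compl[OF T]])
      (use scan_type_II[OF _ s(1) n \<delta> less_imp_le[OF A] t(2) that] in \<open>auto simp: T_def\<close>)
  have "minimax_risk n p DX s A \<le> risk_test n p DX s A T"
    unfolding minimax_risk_def using risk_test_nonneg s A
    by (intro cINF_lower T bdd_belowI[where m=0]) auto
  also have "\<dots> \<le> (?e1 + b) + (?e2 + b)"
    unfolding risk_test_def by (intro add_mono 1 cSUP_least Xi_nonempty s A 2)
  finally show ?thesis .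
qed

text \<open>\<open>K\<close> is the same for all good designs, so the fixed-design bound can be
  integrated over them. The supremum dominates each vector \<open>A * indicator S\<close>, and the
  sum over \<open>S\<close> plays the role of the uniform prior. The 8 is 4 from the good noise
  event times 2 from the good designs.\<close>

lemma minimax_risk_lower:
  fixes \<delta> a A K :: real
  assumes bad: "measure DX {X \<in> space DX. \<not> near_orth n p (\<delta> / real s) X} \<le> 1 / 2"
    and \<delta>: "0 \<le> \<delta>" "\<delta> \<le> 1" and n: "0 < n" and s: "0 < s" "s \<le> p" and a: "0 \<le> a" "a \<le> A" and A: "0 < A"
    and K1: "(A - a) * (2 * sqrt (n * s * (1 + \<delta>))) + (A - a)\<^sup>2 * (n * s * (1 + \<delta>)) / 2 \<le> K"
    and K2: "a * (24 * s * sqrt n) + 2 * a\<^sup>2 * n * s * \<delta>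
        + s * ln (1 + (exp (a\<^sup>2 * n / 2) - 1) * s / p) + ln 8 \<le> K"
  shows "exp (- K) / 8 \<le> minimax_risk n p DX s A"
  unfolding minimax_risk_def
proof (rule cINF_greatest)
  show "tests n p \<noteq> {}" using scan_test_in_tests by blast
next
  fix T assume T: "T \<in> tests n p"
  let ?C = "real (p choose s)" and ?F = "subsets_of_size p s"
  let ?G = "{X \<in> space DX. near_orth n p (\<delta> / real s) X}"
  let ?\<beta> = "\<lambda>S i. A * indicator S i"
  have C: "0 < ?C" using s by simp
  have G: "?G \<in> sets DX" using near_orth_measurable[of n p "\<delta> / real s"] by (simp add: space_DX sets_DX)
  have "{X \<in> space DX. \<not> near_orth n p (\<delta> / real s) X} = space DX - ?G" by auto
  then have pG: "1 / 2 \<le> measure DX ?G" using bad D.prob_compl[OF G] by simp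
  let ?I = "\<lambda>T \<beta> X. \<integral>\<^sup>+e. ennreal (T (shift_on n (mat_vec p X \<beta>) e, X)) \<partial>noiseM n"
  have mI: "?I T' \<beta> \<in> borel_measurable DX" if "T' \<in> tests n p" for T' \<beta>
    using test_compose(1)[OF that, of \<beta>] unfolding response_eq_shift
    by (intro N.borel_measurable_nn_integral) (simp add: split_beta')
  have fixed: "ennreal (?C * (exp (- K) / 4))
      \<le> ennreal ?C * ?I T (\<lambda>_. 0) X + (\<Sum>S\<in>?F. ?I (\<lambda>\<omega>. 1 - T \<omega>) (?\<beta> S) X)" if X: "X \<in> ?G" for X
  proof -
    have X': "X \<in> space DX" using X by simp
    then have X'': "X \<in> space (matM n p)" by (simp only: space_DX)
    interpret lower_bound_setup n p s \<delta> a A K X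
      using X \<delta> n s a K1 K2 by unfold_locales auto
    \<comment> \<open>A test lies between 0 and 1 only on the observation space, whereas the
      fixed-design bound asks for this everywhere; clamping changes nothing on that space.\<close>
    define g where "g y = max 0 (min 1 (T (y, X)))" for y
    have g: "g \<in> borel_measurable (vecM n)"
      using slice_measurable[OF T X'] unfolding g_def by measurable
    have gT: "g y = T (y, X)" if "y \<in> space (vecM n)" for y
    proof -
      have "(y, X) \<in> space (obsM n p)" using that X'' by (simp add: obsM_def space_pair_measure)
      then show ?thesis using T by (simp add: tests_def g_def)
    qed
    have sh: "shift_on n v e \<in> space (vecM n)" for v e
      by (simp add: vecM_def space_PiM shift_on_def)
    have 0: "shift_on n (mat_vec p X (\<lambda>_. 0)) e = e" if "e \<in> space (noiseM n)" for e
      using that by (auto simp: noiseM_def space_PiM shift_on_def mat_vec_def PiE_def extensional_def fun_eq_iff)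
    have sp: "space (noiseM n) = space (vecM n)" by (rule sets_eq_imp_space_eq[OF sets_noiseM])
    have \<beta>: "mat_vec p X (?\<beta> S) = (\<lambda>i. A * col_sum p X S i)" for S
      by (intro ext) (simp only: mat_vec_def sum_distrib_left mult_ac)
    have "(\<integral>\<^sup>+e. ennreal (g e) \<partial>noiseM n) = ?I T (\<lambda>_. 0) X"
      by (intro nn_integral_cong) (simp add: 0 gT sp)
    moreover have "(\<integral>\<^sup>+e. ennreal (1 - g (shift_on n (\<lambda>i. A * col_sum p X S i) e)) \<partial>noiseM n)
        = ?I (\<lambda>\<omega>. 1 - T \<omega>) (?\<beta> S) X" for S
      unfolding \<beta> by (intro nn_integral_cong) (simp only: gT[OF sh])
    moreover have "0 \<le> g y" "g y \<le> 1" for y by (simp_all add: g_def)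
    ultimately show ?thesis
      using fixed_design_lower_bound[OF g] by simp
  qed
  have SUP: "Exp n p DX (?\<beta> S) (\<lambda>\<omega>. 1 - T \<omega>) \<le> (SUP \<beta>\<in>Xi p s A. Exp n p DX \<beta> (\<lambda>\<omega>. 1 - T \<omega>))"
    if "S \<in> ?F" for S
    by (intro cSUP_upper Xi_indicator that A Exp_bdd_above T)
  have "ennreal (?C * (exp (- K) / 8)) \<le> ennreal (?C * (exp (- K) / 4)) * emeasure DX ?G"
    using pG C by (auto simp: D.emeasure_eq_measure ennreal_mult[symmetric] intro!: ennreal_leI)
  also have "\<dots> = (\<integral>\<^sup>+X. ennreal (?C * (exp (- K) / 4)) * indicator ?G X \<partial>DX)"
    by (rule nn_integral_cmult_indicator[OF G, symmetric])
  also have "\<dots> \<le> (\<integral>\<^sup>+X. ennreal ?C * ?I T (\<lambda>_. 0) X + (\<Sum>S\<in>?F. ?I (\<lambda>\<omega>. 1 - T \<omega>) (?\<beta> S) X) \<partial>DX)"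
  proof (intro nn_integral_mono)
    fix X
    show "ennreal (?C * (exp (- K) / 4)) * indicator ?G X
      \<le> ennreal ?C * ?I T (\<lambda>_. 0) X + (\<Sum>S\<in>?F. ?I (\<lambda>\<omega>. 1 - T \<omega>) (?\<beta> S) X)"
      using fixed[of X] by (cases "X \<in> ?G") auto
  qed
  also have "\<dots> = ennreal ?C * (\<integral>\<^sup>+X. ?I T (\<lambda>_. 0) X \<partial>DX) + (\<Sum>S\<in>?F. \<integral>\<^sup>+X. ?I (\<lambda>\<omega>. 1 - T \<omega>) (?\<beta> S) X \<partial>DX)"
    using mI T tests_compl[OF T]
    by (subst nn_integral_add) (auto simp: nn_integral_cmult nn_integral_sum intro!: borel_measurable_times borel_measurable_sum)
  also have "\<dots> = ennreal ?C * ennreal (Exp n p DX (\<lambda>_. 0) T) + (\<Sum>S\<in>?F. ennreal (Exp n p DX (?\<beta> S) (\<lambda>\<omega>. 1 - T \<omega>)))"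
    by (simp only: Exp_eq_nn_integral[OF T] Exp_eq_nn_integral[OF tests_compl[OF T]])
  also have "\<dots> \<le> ennreal ?C * ennreal (Exp n p DX (\<lambda>_. 0) T)
      + (\<Sum>S\<in>?F. ennreal (SUP \<beta>\<in>Xi p s A. Exp n p DX \<beta> (\<lambda>\<omega>. 1 - T \<omega>)))"
    by (intro add_mono order_refl sum_mono ennreal_leI SUP)
  also have "\<dots> = ennreal ?C * (ennreal (Exp n p DX (\<lambda>_. 0) T)
      + ennreal (SUP \<beta>\<in>Xi p s A. Exp n p DX \<beta> (\<lambda>\<omega>. 1 - T \<omega>)))"
    by (simp add: card_subsets_of_size ennreal_of_nat_eq_real_of_nat distrib_left)
  also have "\<dots> = ennreal (?C * risk_test n p DX s A T)"
  proof -
    obtain \<beta> where \<beta>: "\<beta> \<in> Xi p s A" using Xi_nonempty s A by blast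
    have "0 \<le> Exp n p DX \<beta> (\<lambda>\<omega>. 1 - T \<omega>)" by (rule Exp_bounds[OF tests_compl[OF T]])
    also have "\<dots> \<le> (SUP \<beta>\<in>Xi p s A. Exp n p DX \<beta> (\<lambda>\<omega>. 1 - T \<omega>))"
      by (intro cSUP_upper \<beta> Exp_bdd_above T)
    finally show ?thesis
      using Exp_bounds[OF T] by (simp add: risk_test_def ennreal_plus[symmetric] ennreal_mult' del: ennreal_plus)
  qed
  finally have "?C * (exp (- K) / 8) \<le> ?C * risk_test n p DX s A T"
    using C risk_test_nonneg[OF T s(2) A] by (subst (asm) ennreal_le_iff) auto
  then show "exp (- K) / 8 \<le> risk_test n p DX s A T" using C by simp
qed

end

section \<open>Asymptotics\<close>

locale sparse_regime =
  fixes \<alpha> r :: real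
  assumes \<alpha>: "1 / 2 < \<alpha>" "\<alpha> < 1" and r: "\<alpha> < r"
begin

definition rate :: real where "rate = (r - \<alpha>)\<^sup>2 / (4 * r)"

text \<open>The signal level, in units of \<open>sqrt (2 * ln p / n)\<close>, at which the two error
  exponents \<open>u - \<alpha>\<close> and \<open>(sqrt r - sqrt u)\<^sup>2\<close> balance.\<close>

definition u :: real where "u = (r + \<alpha>)\<^sup>2 / (4 * r)"

definition sparsity :: "nat \<Rightarrow> nat" where
  "sparsity p = nat (round (real p powr (1 - \<alpha>)))"

text \<open>The identities behind the balance are
  \<open>(r + \<alpha>)^2 - 4 r \<alpha> = (r - \<alpha>)^2\<close> and
  \<open>sqrt r - sqrt u = (r - \<alpha>) / (2 sqrt r)\<close>.\<close>

lemma pos: "0 < \<alpha>" "0 < r" "0 < u" "0 < rate" "0 < sqrt r - sqrt u"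
  and u_diff: "u - \<alpha> = rate"
  and sqrt_diff: "(sqrt r - sqrt u)\<^sup>2 = rate"
proof -
  show p: "0 < \<alpha>" "0 < r" using \<alpha> r by auto
  show "0 < u" "0 < rate" using \<alpha> r p by (auto simp: u_def rate_def intro!: divide_pos_pos)
  have su: "sqrt u = (r + \<alpha>) / (2 * sqrt r)"
    using p by (simp add: u_def real_sqrt_divide real_sqrt_mult)
  have d: "sqrt r - sqrt u = (r - \<alpha>) / (2 * sqrt r)"
    unfolding su using p by (simp add: field_simps)
  show "0 < sqrt r - sqrt u" unfolding d using p r by (intro divide_pos_pos) auto
  show "(sqrt r - sqrt u)\<^sup>2 = rate" unfolding d using p by (simp add: rate_def power_divide power_mult_distrib)
  show "u - \<alpha> = rate" using p by (simp add: u_def rate_def field_simps power2_eq_square)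
qed

text \<open>\<open>p powr (1 - \<alpha>)\<close> is at least 1 and rounding moves it by at most 1/2,
  which costs at most a factor 2 either way.\<close>

lemma sparsity_bounds:
  assumes p: "0 < p"
  shows "real p powr (1 - \<alpha>) / 2 \<le> real (sparsity p)" "real (sparsity p) \<le> 2 * real p powr (1 - \<alpha>)"
    and "0 < sparsity p" "sparsity p \<le> p"
proof -
  let ?q = "real p powr (1 - \<alpha>)"
  have q1: "1 \<le> ?q" using p \<alpha> by (intro ge_one_powr_ge_zero) auto
  have "\<bar>of_int (round ?q) - ?q\<bar> \<le> 1 / 2" by (rule of_int_round_abs_le)
  moreover have "1 \<le> round ?q" using round_mono[OF q1] by simp
  moreover from \<open>1 \<le> round ?q\<close> have "real (sparsity p) = of_int (round ?q)" "0 < sparsity p"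
    by (auto simp: sparsity_def)
  ultimately show "?q / 2 \<le> real (sparsity p)" "real (sparsity p) \<le> 2 * ?q" "0 < sparsity p"
    using q1 by linarith+
  have "?q \<le> real p powr 1" using p \<alpha> by (intro powr_mono) auto
  then have "round ?q \<le> round (real p)" using p by (intro round_mono) auto
  then show "sparsity p \<le> p" by (simp add: sparsity_def)
qed

end

locale sparse_design = sparse_regime \<alpha> r + random_design n p DX
  for \<alpha> r :: real and n p :: nat and DX :: "(nat \<Rightarrow> nat \<Rightarrow> real) measure" +
  assumes n: "0 < n" and L1: "1 \<le> ln (real p)"
begin

abbreviation "L \<equiv> ln (real p)"
abbreviation "s \<equiv> sparsity p"

lemma p: "0 < p" "1 < real p"
proof -
  show "0 < p" using L1 by (cases "p = 0") auto
  then show "1 < real p" using L1 by (cases "p = 1") auto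
qed

lemmas s = sparsity_bounds[OF p(1)]

lemma powr_p: "real p powr x = exp (x * L)"
  using p by (simp add: powr_def)

text \<open>In the constant \<open>4 * exp 1\<close>, one 2 comes from rounding, in
  \<open>p / s \<le> 2 p^\<alpha>\<close>, the other from the signs, and \<open>exp 1\<close> from
  the binomial estimate.\<close>

lemma choose_sparsity_le:
  "real ((p choose s) * 2 ^ s) \<le> exp (real s * (ln (4 * exp 1) + \<alpha> * L))"
proof -
  have "real p / real s \<le> real p / (real p powr (1 - \<alpha>) / 2)"
    using s p by (intro divide_left_mono) (auto intro!: mult_pos_pos)
  also have "\<dots> = 2 * real p powr \<alpha>"
    using p by (simp add: powr_diff field_simps)
  finally have ps: "real p / real s \<le> 2 * exp (\<alpha> * L)" by (simp add: powr_p)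
  have "real ((p choose s) * 2 ^ s) \<le> (exp 1 * real p / real s) ^ s * 2 ^ s"
    using choose_le_exp_power[OF s(3), of p] by simp
  also have "\<dots> = (2 * exp 1 * (real p / real s)) ^ s"
    by (simp add: power_mult_distrib[symmetric] mult_ac)
  also have "\<dots> \<le> (2 * exp 1 * (2 * exp (\<alpha> * L))) ^ s"
    using ps by (intro power_mono mult_left_mono) auto
  also have "2 * exp 1 * (2 * exp (\<alpha> * L)) = exp (ln (4 * exp 1) + \<alpha> * L)"
    by (simp add: exp_add)
  finally show ?thesis by (simp add: exp_of_nat_mult)
qed

text \<open>The numerical hypotheses depend on \<open>p\<close> only through \<open>L\<close>, so
  they can be checked as limits in one real variable: \<open>e1\<close> is the type I exponent,
  \<open>e2\<close> the type II exponent, and \<open>e3\<close> puts the threshold below the mean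
  signal. The factor 4 counts two errors and two design failures.\<close>

lemma risk_upper:
  assumes bad: "measure DX {X \<in> space DX. \<not> near_orth n p ((1 / L) / real s) X} \<le> exp (- (rate * (real s * L)))"
    and e1: "ln (4 * exp 1) / L + \<alpha> - u / (1 + 1 / L) \<le> - (rate - \<epsilon>)"
    and e2: "rate - \<epsilon> \<le> ((1 - 1 / L) * sqrt r - sqrt u)\<^sup>2 / (1 + 1 / L)"
    and e3: "sqrt u \<le> (1 - 1 / L) * sqrt r" and \<epsilon>: "0 \<le> \<epsilon>"
  shows "minimax_risk n p DX s (sqrt (2 * r * L / n)) \<le> 4 * exp (- ((rate - \<epsilon>) * (real s * L)))"
proof -
  let ?\<delta> = "1 / L" and ?A = "sqrt (2 * r * L / n)"
  define w where "w = sqrt (2 * L * n)"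
  \<comment> \<open>Since \<open>n * A = w * sqrt r\<close>, this is the ideal mean of the scan
    statistic at level \<open>u\<close>.\<close>
  define t where "t = real s * (w * sqrt u)"
  have w: "0 \<le> w" "w\<^sup>2 = 2 * L * n" using L1 by (auto simp: w_def)
  have \<delta>: "0 \<le> ?\<delta>" "?\<delta> \<le> 1" using L1 by auto
  have A: "0 < ?A" using L1 n pos by simp
  have nA: "real n * ?A = w * sqrt r"
  proof -
    have "real n = sqrt (real n * real n)" by simp
    then have "real n * ?A = sqrt (real n * real n * (2 * r * L / n))"
      by (metis real_sqrt_mult)
    also have "real n * real n * (2 * r * L / n) = (2 * L * n) * r" using n by simp
    finally show ?thesis by (simp only: w_def real_sqrt_mult)
  qed
  have m: "real n * (1 - ?\<delta>) * real s * ?A = real s * (w * ((1 - ?\<delta>) * sqrt r))"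
    using nA by (metis mult.assoc mult.commute)
  have t: "0 \<le> t" "t \<le> real n * (1 - ?\<delta>) * real s * ?A"
    unfolding m t_def using w e3 pos by (auto intro!: mult_left_mono)
  \<comment> \<open>Both error exponents have this form, with \<open>z\<close> equal to
    \<open>sqrt u\<close> or to \<open>(1 - 1 / L) * sqrt r - sqrt u\<close>.\<close>
  have cancel: "(real s * (w * z))\<^sup>2 / (2 * (real n * real s * (1 + ?\<delta>))) = (real s * L) * (z\<^sup>2 / (1 + ?\<delta>))" for z
  proof -
    have "(real s * (w * z))\<^sup>2 = (2 * (real n * real s)) * (real s * L * z\<^sup>2)"
      unfolding power_mult_distrib w(2) by (simp add: power2_eq_square)
    then show ?thesis using n s(3) by simp
  qed
  have sL: "0 \<le> real s * L" using L1 by simp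
  have "minimax_risk n p DX s ?A
    \<le> (real ((p choose s) * 2 ^ s) * exp (- t\<^sup>2 / (2 * (real n * real s * (1 + ?\<delta>)))) + exp (- (rate * (real s * L))))
      + (exp (- (real n * (1 - ?\<delta>) * real s * ?A - t)\<^sup>2 / (2 * (real n * real s * (1 + ?\<delta>)))) + exp (- (rate * (real s * L))))"
    by (rule minimax_risk_upper[OF bad s(3) s(4) n \<delta> A t])
  also have "\<dots> \<le> (exp (- ((rate - \<epsilon>) * (real s * L))) + exp (- ((rate - \<epsilon>) * (real s * L))))
      + (exp (- ((rate - \<epsilon>) * (real s * L))) + exp (- ((rate - \<epsilon>) * (real s * L))))"
  proof (intro add_mono)
    show "exp (- (rate * (real s * L))) \<le> exp (- ((rate - \<epsilon>) * (real s * L)))"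
      using mult_right_mono[OF _ sL, of "rate - \<epsilon>" rate] \<epsilon> by simp
    then show "exp (- (rate * (real s * L))) \<le> exp (- ((rate - \<epsilon>) * (real s * L)))" .
    have "real ((p choose s) * 2 ^ s) * exp (- t\<^sup>2 / (2 * (real n * real s * (1 + ?\<delta>))))
      \<le> exp (real s * (ln (4 * exp 1) + \<alpha> * L)) * exp (- ((real s * L) * (u / (1 + ?\<delta>))))"
      using cancel[of "sqrt u"] choose_sparsity_le pos by (intro mult_mono) (auto simp: t_def)
    also have "\<dots> = exp ((real s * L) * (ln (4 * exp 1) / L + \<alpha> - u / (1 + ?\<delta>)))"
      using L1 by (simp add: mult_exp_exp right_diff_distrib distrib_left)
    also have "\<dots> \<le> exp (- ((rate - \<epsilon>) * (real s * L)))"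
      using mult_left_mono[OF e1 sL]
      by (simp only: exp_le_cancel_iff mult_minus_right mult.commute[of "rate - \<epsilon>"])
    finally show "real ((p choose s) * 2 ^ s) * exp (- t\<^sup>2 / (2 * (real n * real s * (1 + ?\<delta>))))
      \<le> exp (- ((rate - \<epsilon>) * (real s * L)))" .
    have "real n * (1 - ?\<delta>) * real s * ?A - t = real s * (w * ((1 - ?\<delta>) * sqrt r - sqrt u))"
      unfolding m t_def by (simp only: right_diff_distrib)
    then show "exp (- (real n * (1 - ?\<delta>) * real s * ?A - t)\<^sup>2 / (2 * (real n * real s * (1 + ?\<delta>))))
      \<le> exp (- ((rate - \<epsilon>) * (real s * L)))"
      using cancel[of "(1 - ?\<delta>) * sqrt r - sqrt u"] mult_left_mono[OF e2 sL] by (simp add: mult.commute)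
  qed
  finally show ?thesis by simp
qed

text \<open>Good designs enter only as a constant factor, so failure probability 1/2 is affordable.
  \<open>e1\<close> and \<open>e2\<close> yield \<open>K1\<close> and \<open>K2\<close> after
  multiplication by \<open>s * L\<close>; terms of order \<open>1 / sqrt L\<close> stem from typical
  noise, those of order \<open>1 / L\<close> from Gram errors and constants.\<close>

lemma risk_lower:
  assumes bad: "measure DX {X \<in> space DX. \<not> near_orth n p ((1 / L) / real s) X} \<le> 1 / 2"
    and e1: "4 * (sqrt r - sqrt u) / sqrt L + rate * (1 + 1 / L) \<le> rate + \<epsilon>"
    and e2: "24 * sqrt (2 * u) / sqrt L + (4 * u + ln 3 + ln 8) / L + rate \<le> rate + \<epsilon>"
  shows "exp (- ((rate + \<epsilon>) * (real s * L))) / 8 \<le> minimax_risk n p DX s (sqrt (2 * r * L / n))"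
proof -
  let ?\<delta> = "1 / L" and ?A = "sqrt (2 * r * L / n)" and ?a = "sqrt (2 * u * L / n)" and ?K = "(rate + \<epsilon>) * (real s * L)"
  define \<kappa> where "\<kappa> = sqrt r - sqrt u"
  have \<kappa>: "0 < \<kappa>" "\<kappa>\<^sup>2 = rate" using pos(5) sqrt_diff by (simp_all add: \<kappa>_def)
  have \<delta>: "0 \<le> ?\<delta>" "?\<delta> \<le> 1" using L1 by auto
  have A: "0 < ?A" using L1 n pos by simp
  have ur: "u \<le> r" using pos(5) by simp
  have a: "0 \<le> ?a" "?a \<le> ?A" using ur pos L1 by (auto intro!: divide_right_mono mult_right_mono)
  have s1: "1 \<le> real s" using s by simp
  have sL: "0 \<le> real s * L" using L1 by simp
  have LL: "sqrt L * sqrt L = L" "0 < sqrt L" using L1 by auto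
  have Aa: "?A - ?a = \<kappa> * sqrt (2 * L / n)"
    by (simp add: \<kappa>_def left_diff_distrib real_sqrt_mult[symmetric] mult_ac)
  have K1: "(?A - ?a) * (2 * sqrt (n * s * (1 + ?\<delta>))) + (?A - ?a)\<^sup>2 * (n * s * (1 + ?\<delta>)) / 2 \<le> ?K"
  proof -
    have "(?A - ?a) * (2 * sqrt (n * s * (1 + ?\<delta>))) = 2 * \<kappa> * sqrt (2 * L * (s * (1 + ?\<delta>)))"
      unfolding Aa using n by (simp add: real_sqrt_mult[symmetric] mult_ac)
    also have "\<dots> \<le> 2 * \<kappa> * sqrt ((4 * L) * (real s * real s))"
    proof (intro mult_left_mono real_sqrt_le_mono)
      \<comment> \<open>Deliberately crude: \<open>s\<^sup>2\<close> instead of \<open>s\<close>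
        under the root makes the noise term linear in \<open>s\<close>, which is still smaller than
        \<open>s * L\<close> by a factor of order \<open>1 / sqrt L\<close>.\<close>
      have "real s * (1 + ?\<delta>) \<le> (real s * real s) * 2"
        using s1 \<delta> mult_left_mono[OF s1, of "real s"] by (intro mult_mono) auto
      then show "2 * L * (s * (1 + ?\<delta>)) \<le> (4 * L) * (real s * real s)"
        using L1 mult_left_mono[of "real s * (1 + ?\<delta>)" "(real s * real s) * 2" "2 * L"] by simp
    qed (use \<kappa> in auto)
    also have "\<dots> = (real s * L) * (4 * \<kappa> / sqrt L)"
      using LL L1 by (simp add: real_sqrt_mult field_simps)
    finally have 1: "(?A - ?a) * (2 * sqrt (n * s * (1 + ?\<delta>))) \<le> (real s * L) * (4 * \<kappa> / sqrt L)" .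
    have 2: "(?A - ?a)\<^sup>2 * (n * s * (1 + ?\<delta>)) / 2 = (real s * L) * (rate * (1 + ?\<delta>))"
    proof -
      have "(?A - ?a)\<^sup>2 * (n * s * (1 + ?\<delta>)) / 2 = rate * (2 * L / n) * (n * s * (1 + ?\<delta>)) / 2"
        unfolding Aa power_mult_distrib \<kappa>(2) using L1 by simp
      also have "\<dots> = (real s * L) * (rate * (1 + ?\<delta>))" using n by simp
      finally show ?thesis .
    qed
    have "(real s * L) * (4 * \<kappa> / sqrt L) + (real s * L) * (rate * (1 + ?\<delta>))
        = (real s * L) * (4 * \<kappa> / sqrt L + rate * (1 + ?\<delta>))" by (simp only: distrib_left)
    also have "\<dots> \<le> (real s * L) * (rate + \<epsilon>)"
      using e1 sL unfolding \<kappa>_def by (intro mult_left_mono)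
    finally show ?thesis using 1 2 by (simp only: mult.commute[of "rate + \<epsilon>"])
  qed
  have K2: "?a * (24 * real s * sqrt n) + 2 * ?a\<^sup>2 * n * s * ?\<delta>
        + s * ln (1 + (exp (?a\<^sup>2 * n / 2) - 1) * s / p) + ln 8 \<le> ?K"
  proof -
    have "?a * sqrt n = sqrt (2 * u) * sqrt L" using n by (simp add: real_sqrt_mult[symmetric])
    also have "\<dots> = L * (sqrt (2 * u) / sqrt L)" using LL by (simp add: field_simps)
    finally have h: "?a * sqrt n = L * (sqrt (2 * u) / sqrt L)" .
    have "?a * (24 * real s * sqrt n) = (24 * real s) * (?a * sqrt n)" by simp
    then have 1: "?a * (24 * real s * sqrt n) = (real s * L) * (24 * sqrt (2 * u) / sqrt L)"
      unfolding h by simp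
    have a2: "?a\<^sup>2 * n = 2 * u * L" using n pos L1 by simp
    have 2: "2 * ?a\<^sup>2 * n * s * ?\<delta> = (real s * L) * (4 * u / L)"
    proof -
      have "2 * ?a\<^sup>2 * n * s * ?\<delta> = 2 * (?a\<^sup>2 * n) * s * ?\<delta>" by simp
      then show ?thesis unfolding a2 using L1 by simp
    qed
    have "(exp (?a\<^sup>2 * n / 2) - 1) * s / p \<le> exp (u * L) * (2 * real p powr (1 - \<alpha>)) / p"
      using s a2 by (intro divide_right_mono mult_mono) auto
    also have "\<dots> = 2 * (exp (u * L) * (real p powr (1 - \<alpha>) / real p powr 1))"
      using p by simp
    also have "\<dots> = 2 * (exp (u * L) * exp (- (\<alpha> * L)))"
    proof -
      have "real p powr (1 - \<alpha>) / real p powr 1 = real p powr (- \<alpha>)"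
        by (simp only: powr_diff[symmetric]) simp
      then show ?thesis by (simp only: powr_p mult_minus_left)
    qed
    also have "\<dots> = 2 * exp (rate * L)"
      unfolding mult_exp_exp u_diff[symmetric] by (simp add: left_diff_distrib)
    finally have "(exp (?a\<^sup>2 * n / 2) - 1) * s / p \<le> 2 * exp (rate * L)" .
    \<comment> \<open>Here \<open>u > \<alpha>\<close> matters: since \<open>rate\<close> is
      positive, the summand 1 is absorbed and the logarithm is \<open>rate * L\<close> up to a
      constant.\<close>
    moreover have "1 \<le> exp (rate * L)" using pos L1 by simp
    ultimately have "1 + (exp (?a\<^sup>2 * n / 2) - 1) * s / p \<le> 3 * exp (rate * L)" by linarith
    moreover have "0 < 1 + (exp (?a\<^sup>2 * n / 2) - 1) * s / p"
      using a2 pos L1 by (intro add_pos_nonneg divide_nonneg_nonneg mult_nonneg_nonneg) auto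
    ultimately have "ln (1 + (exp (?a\<^sup>2 * n / 2) - 1) * s / p) \<le> ln (3 * exp (rate * L))" by simp
    also have "\<dots> = L * (ln 3 / L + rate)" using L1 by (simp add: ln_mult field_simps)
    finally have 3: "s * ln (1 + (exp (?a\<^sup>2 * n / 2) - 1) * s / p) \<le> (real s * L) * (ln 3 / L + rate)"
      using mult_left_mono[of _ "L * (ln 3 / L + rate)" "real s"] by (simp add: mult.assoc)
    have "ln 8 \<le> real s * ln 8" using s1 mult_right_mono[OF s1, of "ln 8"] by simp
    also have "\<dots> = (real s * L) * (ln 8 / L)" using L1 by simp
    finally have 4: "ln 8 \<le> (real s * L) * (ln 8 / L)" .
    have "(real s * L) * (24 * sqrt (2 * u) / sqrt L) + (real s * L) * (4 * u / L)
        + (real s * L) * (ln 3 / L + rate) + (real s * L) * (ln 8 / L)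
      = (real s * L) * (24 * sqrt (2 * u) / sqrt L + (4 * u + ln 3 + ln 8) / L + rate)"
      unfolding add_divide_distrib by (simp only: distrib_left add_ac)
    also have "\<dots> \<le> ?K" using mult_left_mono[OF e2 sL] by (simp only: mult_ac)
    finally show ?thesis using 1 2 3 4 by linarith
  qed
  show ?thesis by (rule minimax_risk_lower[OF bad \<delta> n s(3) s(4) a A K1 K2])
qed

end

section \<open>Near-orthogonality of both design classes\<close>

lemma orth_design_near_orth:
  assumes "orth_design n p DX" "0 \<le> d"
  shows "measure DX {X \<in> space DX. \<not> near_orth n p d X} = 0"
proof -
  interpret prob_space DX using assms by (simp add: orth_design_def)
  have ae: "AE X in DX. \<forall>j<p. \<forall>k<p. (\<Sum>i<n. X i j * X i k) = (if j = k then real n else 0)"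
    using assms by (simp add: orth_design_def)
  have "AE X in DX. near_orth n p d X"
    using ae by eventually_elim (use assms(2) in \<open>auto simp: near_orth_def\<close>)
  then have "emeasure DX {X \<in> space DX. \<not> near_orth n p d X} = 0"
    by (intro emeasure_eq_0_AE) simp
  then show ?thesis by (simp add: measure_def)
qed

lemma subG_design_near_orth:
  assumes "subG_design n p \<sigma>2 DX" "0 \<le> d" "d \<le> 1" "\<sigma>2 \<le> \<tau>" "1 \<le> \<tau>"
  shows "measure DX {X \<in> space DX. \<not> near_orth n p d X}
     \<le> 2 * (real p)\<^sup>2 * exp (- (real n * d\<^sup>2 / (2048 * \<tau>\<^sup>2)))"
proof -
  obtain \<mu> where row: "subG_row p \<sigma>2 \<mu>" and DX: "DX = PiM {..<n} (\<lambda>_. \<mu>)"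
    using assms by (auto simp: subG_design_def)
  interpret subG p \<sigma>2 \<tau> \<mu> by unfold_locales (use row assms in auto)
  interpret D: prob_space DX unfolding DX by (intro prob_space_PiM prob_space_axioms)
  show ?thesis
    using near_orth_tail[OF assms(2,3), of n]
    by (simp add: DX[symmetric] D.emeasure_eq_measure ennreal_le_iff)
qed

lemma subG_design_random: "subG_design n p \<sigma>2 DX \<Longrightarrow> random_design n p DX"
  unfolding subG_design_def subG_row_def random_design_def matM_def
  by (auto intro!: prob_space_PiM sets_PiM_cong)

lemma orth_design_random: "orth_design n p DX \<Longrightarrow> random_design n p DX"
  by (simp add: orth_design_def random_design_def)

lemma filterlim_ln_real_at_top: "filterlim (\<lambda>p. ln (real p)) at_top at_top"
  by real_asymp

text \<open>\<open>\<alpha> > 1/2\<close> gives \<open>s\<^sup>2 \<le> 4 * p\<close>, so with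
  \<open>d = 1 / (L * s)\<close> and \<open>n \<ge> p\<^sup>2\<close> the product
  \<open>n * d\<^sup>2\<close> is at least \<open>p / (4 * L\<^sup>2)\<close>. This beats the
  logarithm of the union bound factor \<open>2 * p\<^sup>2\<close> as well as the target
  \<open>rate * s * L\<close>, which is at most of order \<open>sqrt p * L\<close>.\<close>

lemma (in sparse_regime) subG_failure_eventually:
  assumes subG: "\<And>p. subG_design (n p) p \<sigma>2 (DX p)"
    and np: "filterlim (\<lambda>p. real (n p) / (real p)\<^sup>2) at_top at_top"
  shows "eventually (\<lambda>p. measure (DX p) {X \<in> space (DX p).
      \<not> near_orth (n p) p ((1 / ln (real p)) / real (sparsity p)) X}
        \<le> exp (- (rate * (real (sparsity p) * ln (real p))))) at_top"
proof -
  define \<tau> where "\<tau> = max \<sigma>2 1"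
  \<comment> \<open>8192 is the 2048 of the tail bound times the 4 in
    \<open>s\<^sup>2 \<le> 4 * p\<close>.\<close>
  define c where "c = 1 / (8192 * \<tau>\<^sup>2)"
  have \<tau>: "\<sigma>2 \<le> \<tau>" "1 \<le> \<tau>" and c: "0 < c" by (auto simp: \<tau>_def c_def)
  have "((\<lambda>p::nat. (ln 2 + 2 * ln (real p) + 2 * rate * (sqrt (real p) * ln (real p))) * (ln (real p))\<^sup>2 / real p) \<longlongrightarrow> 0) at_top"
    by real_asymp
  then have "eventually (\<lambda>p::nat. (ln 2 + 2 * ln (real p) + 2 * rate * (sqrt (real p) * ln (real p))) * (ln (real p))\<^sup>2 / real p < c) at_top"
    using c by (rule order_tendstoD)
  moreover have "eventually (\<lambda>p. 1 \<le> real (n p) / (real p)\<^sup>2) at_top"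
    using np by (simp add: filterlim_at_top)
  moreover have "eventually (\<lambda>p. 1 \<le> ln (real p)) at_top"
    using filterlim_ln_real_at_top by (simp add: filterlim_at_top)
  ultimately show ?thesis
  proof eventually_elim
    case (elim p)
    define L where "L = ln (real p)"
    define s where "s = sparsity p"
    have L: "1 \<le> L" using elim by (simp add: L_def)
    then have p: "0 < p" by (cases "p = 0") (auto simp: L_def)
    then have p1: "1 \<le> real p" by simp
    note s = sparsity_bounds[OF p, folded s_def]
    have s1: "1 \<le> real s" using s by simp
    have "real p powr (1 - \<alpha>) \<le> real p powr (1 / 2)" using p1 \<alpha> by (intro powr_mono) auto
    then have sp: "real s \<le> 2 * sqrt (real p)" using s(2) by (simp add: powr_half_sqrt)
    then have "(real s)\<^sup>2 \<le> (2 * sqrt (real p))\<^sup>2" by (intro power_mono) auto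
    then have s2: "(real s)\<^sup>2 \<le> 4 * real p" by (simp add: power_mult_distrib)
    define d where "d = (1 / L) / real s"
    have d: "0 \<le> d" "d \<le> 1"
      using L s1 mult_mono[OF L s1] by (auto simp: d_def divide_simps)
    have n: "(real p)\<^sup>2 \<le> real (n p)" using elim(2) p by (simp add: field_simps)
    have "real p / (4 * L\<^sup>2) = (real p)\<^sup>2 / (L\<^sup>2 * (4 * real p))"
      using p by (simp add: power2_eq_square)
    also have "\<dots> \<le> (real p)\<^sup>2 / (L\<^sup>2 * (real s)\<^sup>2)"
      using s2 s1 L p by (intro divide_left_mono mult_left_mono mult_pos_pos) auto
    also have "\<dots> = (real p)\<^sup>2 * d\<^sup>2" by (simp add: d_def power_divide power_mult_distrib)
    also have "\<dots> \<le> real (n p) * d\<^sup>2" using n by (intro mult_right_mono) auto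
    finally have nd: "c * real p / L\<^sup>2 \<le> real (n p) * d\<^sup>2 / (2048 * \<tau>\<^sup>2)"
      using \<tau> divide_right_mono[of "real p / (4 * L\<^sup>2)" "real (n p) * d\<^sup>2" "2048 * \<tau>\<^sup>2"]
      by (simp add: c_def field_simps)
    have "rate * (real s * L) \<le> rate * ((2 * sqrt (real p)) * L)"
      using sp L pos by (intro mult_left_mono mult_right_mono) auto
    then have "ln 2 + 2 * L + rate * (real s * L) \<le> ln 2 + 2 * L + rate * ((2 * sqrt (real p)) * L)"
      by simp
    also have "\<dots> < c * real p / L\<^sup>2"
      using elim(1) L p by (simp add: L_def[symmetric] field_simps)
    finally have main: "ln 2 + 2 * L + rate * (real s * L) \<le> real (n p) * d\<^sup>2 / (2048 * \<tau>\<^sup>2)"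
      using nd by linarith
    have "measure (DX p) {X \<in> space (DX p). \<not> near_orth (n p) p d X}
        \<le> 2 * (real p)\<^sup>2 * exp (- (real (n p) * d\<^sup>2 / (2048 * \<tau>\<^sup>2)))"
      by (rule subG_design_near_orth[OF subG d \<tau>])
    also have "2 * (real p)\<^sup>2 = exp (ln 2 + 2 * L)"
      using p by (simp add: exp_add exp_double L_def)
    also have "exp (ln 2 + 2 * L) * exp (- (real (n p) * d\<^sup>2 / (2048 * \<tau>\<^sup>2))) \<le> exp (- (rate * (real s * L)))"
      using main by (simp add: mult_exp_exp)
    finally show ?case by (simp only: d_def s_def L_def)
  qed
qed

text \<open>Collects what is required of \<open>x = ln p\<close>. Besides the hypotheses of the two
  risk bounds, \<open>ln 8 / x < \<epsilon>\<close> absorbs their prefactors 4 and 1/8, and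
  \<open>exp (- (rate * x)) \<le> 1 / 2\<close> turns the failure bound into the 1/2 of the lower
  bound.\<close>

lemma (in sparse_regime) exponent_conditions_eventually:
  assumes \<epsilon>: "0 < \<epsilon>"
  shows "eventually (\<lambda>x. ln (4 * exp 1) / x + \<alpha> - u / (1 + 1 / x) \<le> - (rate - \<epsilon>)
    \<and> rate - \<epsilon> \<le> ((1 - 1 / x) * sqrt r - sqrt u)\<^sup>2 / (1 + 1 / x)
    \<and> sqrt u \<le> (1 - 1 / x) * sqrt r
    \<and> 4 * (sqrt r - sqrt u) / sqrt x + rate * (1 + 1 / x) \<le> rate + \<epsilon>
    \<and> 24 * sqrt (2 * u) / sqrt x + (4 * u + ln 3 + ln 8) / x + rate \<le> rate + \<epsilon>
    \<and> ln 8 / x < \<epsilon> \<and> exp (- (rate * x)) \<le> 1 / 2 \<and> 1 \<le> x) at_top"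
proof (intro eventually_conj)
  have "((\<lambda>x::real. ln (4 * exp 1) / x + \<alpha> - u / (1 + 1 / x)) \<longlongrightarrow> \<alpha> - u) at_top" by real_asymp
  from order_tendstoD(2)[OF this, of "- (rate - \<epsilon>)"]
  show "eventually (\<lambda>x. ln (4 * exp 1) / x + \<alpha> - u / (1 + 1 / x) \<le> - (rate - \<epsilon>)) at_top"
    using u_diff \<epsilon> by (auto elim!: eventually_mono)
  have inv: "((\<lambda>x::real. 1 / x) \<longlongrightarrow> 0) at_top" by real_asymp
  have "((\<lambda>x::real. ((1 - 1 / x) * sqrt r - sqrt u)\<^sup>2 / (1 + 1 / x)) \<longlongrightarrow> ((1 - 0) * sqrt r - sqrt u)\<^sup>2 / (1 + 0)) at_top"
    by (intro tendsto_divide tendsto_power tendsto_diff tendsto_mult tendsto_const tendsto_add inv) simp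
  then have "((\<lambda>x::real. ((1 - 1 / x) * sqrt r - sqrt u)\<^sup>2 / (1 + 1 / x)) \<longlongrightarrow> rate) at_top"
    by (simp add: sqrt_diff)
  from order_tendstoD(1)[OF this, of "rate - \<epsilon>"]
  show "eventually (\<lambda>x. rate - \<epsilon> \<le> ((1 - 1 / x) * sqrt r - sqrt u)\<^sup>2 / (1 + 1 / x)) at_top"
    using \<epsilon> by (auto elim!: eventually_mono)
  have "((\<lambda>x::real. (1 - 1 / x) * k) \<longlongrightarrow> k) at_top" for k by real_asymp
  from order_tendstoD(1)[OF this[of "sqrt r"], of "sqrt u"]
  show "eventually (\<lambda>x. sqrt u \<le> (1 - 1 / x) * sqrt r) at_top"
    using pos(5) by (auto elim!: eventually_mono)
  have "((\<lambda>x::real. 4 * k / sqrt x + rate * (1 + 1 / x)) \<longlongrightarrow> rate) at_top" for k by real_asymp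
  from order_tendstoD(2)[OF this[of "sqrt r - sqrt u"], of "rate + \<epsilon>"]
  show "eventually (\<lambda>x. 4 * (sqrt r - sqrt u) / sqrt x + rate * (1 + 1 / x) \<le> rate + \<epsilon>) at_top"
    using \<epsilon> by (auto elim!: eventually_mono)
  have "((\<lambda>x::real. 24 * k / sqrt x + (4 * u + ln 3 + ln 8) / x + rate) \<longlongrightarrow> rate) at_top" for k by real_asymp
  from order_tendstoD(2)[OF this[of "sqrt (2 * u)"], of "rate + \<epsilon>"]
  show "eventually (\<lambda>x. 24 * sqrt (2 * u) / sqrt x + (4 * u + ln 3 + ln 8) / x + rate \<le> rate + \<epsilon>) at_top"
    using \<epsilon> by (auto elim!: eventually_mono)
  have "((\<lambda>x::real. ln 8 / x) \<longlongrightarrow> 0) at_top" by real_asymp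
  from order_tendstoD(2)[OF this \<epsilon>] show "eventually (\<lambda>x::real. ln 8 / x < \<epsilon>) at_top" .
  have "((\<lambda>x::real. exp (- (rate * x))) \<longlongrightarrow> 0) at_top" using pos(4) by real_asymp
  from order_tendstoD(2)[OF this, of "1 / 2"]
  show "eventually (\<lambda>x::real. exp (- (rate * x)) \<le> 1 / 2) at_top"
    by (auto elim!: eventually_mono)
  show "eventually (\<lambda>x::real. 1 \<le> x) at_top" by (rule eventually_ge_at_top)
qed

theorem mainTheorem5:
  fixes \<alpha> r \<sigma>2 :: real and n :: "nat \<Rightarrow> nat"
    and DX :: "nat \<Rightarrow> (nat \<Rightarrow> nat \<Rightarrow> real) measure"
  assumes "1/2 < \<alpha>" and "\<alpha> < 1" and "\<alpha> < r"
    and "filterlim n at_top at_top"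
    and "((\<forall>p. subG_design (n p) p \<sigma>2 (DX p)) \<and>
           filterlim (\<lambda>p. real (n p) / (real p)\<^sup>2) at_top at_top)
       \<or> ((\<forall>p. orth_design (n p) p (DX p)) \<and> (\<forall>p. p \<le> n p))"
  shows "((\<lambda>p. ln (minimax_risk (n p) p (DX p) (nat (round (real p powr (1 - \<alpha>))))
                    (sqrt (2 * r * ln (real p) / real (n p))))
              / (real (nat (round (real p powr (1 - \<alpha>)))) * ln (real p)))
          \<longlongrightarrow> - ((r - \<alpha>)\<^sup>2 / (4 * r))) at_top"
proof -
  interpret sparse_regime \<alpha> r by unfold_locales (use assms in auto)
  have random: "random_design (n p) p (DX p)" for p
    using assms(5) subG_design_random orth_design_random by blast
  have failure: "eventually (\<lambda>p. measure (DX p) {X \<in> space (DX p).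
      \<not> near_orth (n p) p ((1 / ln (real p)) / real (sparsity p)) X}
        \<le> exp (- (rate * (real (sparsity p) * ln (real p))))) at_top"
    using assms(5)
  proof
    assume *: "(\<forall>p. orth_design (n p) p (DX p)) \<and> (\<forall>p. p \<le> n p)"
    show ?thesis
    proof (intro always_eventually allI)
      fix p
      \<comment> \<open>Holds for every \<open>p\<close>: the logarithm of a natural number is
        nonnegative, with \<open>ln 0 = 0\<close>, and division by 0 gives 0.\<close>
      have "0 \<le> (1 / ln (real p)) / real (sparsity p)" by (cases "p = 0") auto
      then show "measure (DX p) {X \<in> space (DX p).
        \<not> near_orth (n p) p ((1 / ln (real p)) / real (sparsity p)) X}
        \<le> exp (- (rate * (real (sparsity p) * ln (real p))))"
        using orth_design_near_orth * by simp
    qed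
  qed (use subG_failure_eventually in blast)
  have "((\<lambda>p. ln (minimax_risk (n p) p (DX p) (sparsity p) (sqrt (2 * r * ln (real p) / real (n p))))
              / (real (sparsity p) * ln (real p))) \<longlongrightarrow> - rate) at_top"
  proof (rule tendstoI)
    fix e :: real assume "0 < e"
    \<comment> \<open>One \<open>\<epsilon>\<close> is lost in the exponent and one in the
      prefactor.\<close>
    define \<epsilon> where "\<epsilon> = e / 2"
    have \<epsilon>: "0 < \<epsilon>" using \<open>0 < e\<close> by (simp add: \<epsilon>_def)
    have "eventually (\<lambda>p. 1 \<le> n p) at_top" using assms(4) by (simp add: filterlim_at_top)
    then show "eventually (\<lambda>p. dist (ln (minimax_risk (n p) p (DX p) (sparsity p) (sqrt (2 * r * ln (real p) / real (n p))))
              / (real (sparsity p) * ln (real p))) (- rate) < e) at_top"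
      using failure eventually_compose_filterlim[OF exponent_conditions_eventually[OF \<epsilon>] filterlim_ln_real_at_top]
    proof eventually_elim
      case (elim p)
      let ?R = "minimax_risk (n p) p (DX p) (sparsity p) (sqrt (2 * r * ln (real p) / real (n p)))"
      interpret random_design "n p" p "DX p" by (rule random)
      interpret sparse_design \<alpha> r "n p" p "DX p" by unfold_locales (use elim in auto)
      have s1: "1 \<le> real (sparsity p)" using s by simp
      have LsL: "L \<le> real (sparsity p) * L" and sL: "0 < real (sparsity p) * L"
        using L1 s1 mult_right_mono[OF s1, of L] by auto
      have "rate * L \<le> rate * (real (sparsity p) * L)" using LsL pos by (intro mult_left_mono) auto
      then have "exp (- (rate * (real (sparsity p) * L))) \<le> exp (- (rate * L))" by simp
      then have half: "exp (- (rate * (real (sparsity p) * L))) \<le> 1 / 2" using elim by linarith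
      have up: "?R \<le> 4 * exp (- ((rate - \<epsilon>) * (real (sparsity p) * L)))"
        using elim \<epsilon> by (intro risk_upper) auto
      have lo: "exp (- ((rate + \<epsilon>) * (real (sparsity p) * L))) / 8 \<le> ?R"
        using elim order_trans[OF elim(2) half] by (intro risk_lower) auto
      have dv: "(x - y * z) / z = x / z - y" if "0 < z" for x y z :: real
        using that by (simp add: diff_divide_distrib)
      have R: "0 < ?R" by (rule less_le_trans[OF _ lo]) simp
      have "ln ?R \<le> ln (4 * exp (- ((rate - \<epsilon>) * (real (sparsity p) * L))))"
        using up R by simp
      also have "\<dots> = ln 4 - (rate - \<epsilon>) * (real (sparsity p) * L)" by (simp add: ln_mult)
      finally have "ln ?R / (real (sparsity p) * L) \<le> (ln 4 - (rate - \<epsilon>) * (real (sparsity p) * L)) / (real (sparsity p) * L)"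
        using sL by (intro divide_right_mono) auto
      also have "\<dots> = ln 4 / (real (sparsity p) * L) - (rate - \<epsilon>)" by (rule dv[OF sL])
      finally have 1: "ln ?R / (real (sparsity p) * L) \<le> ln 4 / (real (sparsity p) * L) - (rate - \<epsilon>)" .
      have "ln (exp (- ((rate + \<epsilon>) * (real (sparsity p) * L))) / 8) \<le> ln ?R"
        using lo R by simp
      moreover have "ln (exp (- ((rate + \<epsilon>) * (real (sparsity p) * L))) / 8) = - ln 8 - (rate + \<epsilon>) * (real (sparsity p) * L)"
        by (simp add: ln_div)
      ultimately have "(- ln 8 - (rate + \<epsilon>) * (real (sparsity p) * L)) / (real (sparsity p) * L) \<le> ln ?R / (real (sparsity p) * L)"
        using sL by (intro divide_right_mono) auto
      moreover have "(- ln 8 - (rate + \<epsilon>) * (real (sparsity p) * L)) / (real (sparsity p) * L)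
          = - ln 8 / (real (sparsity p) * L) - (rate + \<epsilon>)" by (rule dv[OF sL])
      ultimately have 2: "- (ln 8 / (real (sparsity p) * L)) - (rate + \<epsilon>) \<le> ln ?R / (real (sparsity p) * L)" by simp
      have "ln 8 / (real (sparsity p) * L) \<le> ln 8 / L"
        using LsL L1 sL by (intro divide_left_mono mult_pos_pos) auto
      moreover have "ln 4 / (real (sparsity p) * L) \<le> ln 8 / (real (sparsity p) * L)"
        using sL by (intro divide_right_mono) auto
      ultimately have "\<bar>ln ?R / (real (sparsity p) * L) - (- rate)\<bar> < 2 * \<epsilon>"
        using 1 2 elim by linarith
      then show ?case by (simp add: dist_real_def \<epsilon>_def)
    qed
  qed
  then show ?thesis by (simp only: sparsity_def rate_def)
qed

end
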